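(* Let $G$ be a group acting faithfully on a tree $T$. The action $(G,T)$ is isomorphic to the action of the universal group of a local action diagram (on its associated tree) by an isomorphism of the trees if and only if it is isomorphic to the action of the universal group of a free graph of group actions on the associated tree by an isomorphism of the trees.
   Context: **Graphs.** A graph $\Gamma$ has a vertex set $V\Gamma$, an arc set $A\Gamma$, maps $o,t\colon A\Gamma\to V\Gamma$ (origin, terminus) and an involution $a\mapsto\bar a$ on arcs with $o(a)=t(\bar a)$; an arc with $\bar a=a$ is called self-reverse (loops with $\bar a\ne a$ are also allowed). Graph morphisms preserve $o$, $t$ and reversal. $\mathrm{Star}(v)=t^{-1}(v)$. A tree is a connected graph without loops and without two arcs having the same origin and the same terminus, which has no simple cycles of length $\ge 3$. Two actions $(G,T)$, $(G',T')$ are isomorphic by an isomorphism of the trees if there are a group isomorphism $\varphi\colon G\to G'$ and a tree isomorphism $\Phi\colon T\to T'$ with $\varphi(g)\Phi=\Phi g$ for all $g\in G$. The action of a universal group on its tree is understood as the action of the permutation group it induces there. **Local action diagrams.** A local action diagram consists of a connected graph $\Gamma$, a set $X(a)$ for each arc $a$ of $\Gamma$, and for each vertex $v$ a group $G(v)\le\mathrm{Sym}(X(v))$, where $X(v)=\bigsqcup_{t(a)=v}X(a)$, such that each $X(a)$ with $t(a)=v$ is an orbit of $G(v)$. (No closedness of $G(v)$ is assumed.) Its associated tree is a tree $T$ together with a surjective graph morphism $\pi\colon T\to\Gamma$ and a map $\mathcal L\colon AT\to\bigsqcup_{a\in A\Gamma}X(a)$ such that for every $v\in VT$ and $a\in A\Gamma$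 with $t(a)=\pi(v)$, $\mathcal L$ restricts to a bijection from $\{b\in\mathrm{Star}(v)\mid\pi(b)=a\}$ to $X(a)$. Let $\mathcal L_v\colon\mathrm{Star}(v)\to X(\pi(v))$ be the restriction of $\mathcal L$ to $\mathrm{Star}(v)$. The universal group of the diagram is the group of all automorphisms $g$ of $T$ with $\pi g=\pi$ such that $\mathcal L_{g(v)}\,g\,\mathcal L_v^{-1}\in G(\pi(v))$ for every $v\in VT$. **Graph of group actions (gga).** A permutation group action $(G,X)$ is a faithful action on a non-empty set; for $Y\subseteq X$, $G^Y$ is the permutation group induced on $Y$ by the setwise stabiliser of $Y$; an embedding $(H,Y)\hookrightarrow(G,X)$ is given by an injection $\Phi\colon Y\to X$ such that $h\mapsto\Phi h\Phi^{-1}$ is an isomorphism $H\to G^{\Phi(Y)}$. A gga $\mathcal G$ consists of: a connected graph $\Delta$ (base graph); for every $v\in V\Delta$ a permutation group action $(G(v),X(v))$; for every $a\in A\Delta$ a permutation group action $(H(a),Y(a))$ with $(H(\bar a),Y(\bar a))=(H(a),Y(a))$ and an embedding $\Phi_a\colon(H(a),Y(a))\hookrightarrow(G(t(a)),X(t(a)))$; and for every self-reverse arc $a$ a permutation $h_a$ of $Y(a)$ with $h_aH(a)h_a^{-1}=H(a)$ and $h_a^2\in H(a)$. An $a$-adhesion map is a map $g\Phi_a$ with $g\in G(t(a))$; its image is an $a$-adhesion set. If $a$ is self-reverse, a twisted $a$-adhesion map is a map $g\Phi_ah_a$ with $g\in G(t(a))$. The gga is free if for every arc $a$ the action $(H(a),Y(a))$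 is the action of the trivial group on a one-element set. **Scaffolding.** A scaffolding $(\Sigma,\sim,\pi,p)$ for $\mathcal G$ is a graph $\Sigma$ with an equivalence relation $\sim$ on $V\Sigma$, extended to $A\Sigma$ by $a\sim a'$ iff $o(a)\sim o(a')$ and $t(a)\sim t(a')$ (write $[x]$ for the class of $x$ as a set and $\llbracket x\rrbracket$ for the class as a vertex or arc of $T_\Sigma:=\Sigma/\!\sim$), such that: (i) $T_\Sigma$ is a tree; (ii) no arc of $\Sigma$ has both ends in the same class; (iii) $\pi\colon T_\Sigma\to\Delta$ is a graph morphism; (iv) $p$ (a legal colouring) is a map from $V\Sigma\cup A\Sigma$ to $\bigcup_v X(v)\cup\bigcup_a Y(a)$ such that: $p$ restricts to bijections $[v]\to X(\pi(\llbracket v\rrbracket))$ and $[a]\to Y(\pi(\llbracket a\rrbracket))$; $p(\bar b)=p(b)$ for every arc $b$; if $\Psi_{\llbracket a\rrbracket}$ is the unique map with $\Psi_{\llbracket a\rrbracket}(p(b))=p(t(b))$ for all $b\in[a]$, then $\Psi_{\llbracket a\rrbracket}$ is a $\pi(\llbracket a\rrbracket)$-adhesion map when $\pi(\llbracket a\rrbracket)$ is not self-reverse, while when $\pi(\llbracket a\rrbracket)$ is self-reverse one of $\Psi_{\llbracket a\rrbracket},\Psi_{\llbracket\bar a\rrbracket}$ is a $\pi(\llbracket a\rrbracket)$-adhesion map and the other is a twisted one; and for every vertex $\llbracket v\rrbracket$ of $T_\Sigma$, every $b\in A\Delta$ with $t(b)=\pi(\llbracket v\rrbracket)$ and every $b$-adhesion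 set $S$, there is exactly one arc $\llbracket a\rrbracket$ of $T_\Sigma$ with $t(\llbracket a\rrbracket)=\llbracket v\rrbracket$, $\pi(\llbracket a\rrbracket)=b$ and $\Psi_{\llbracket a\rrbracket}(Y(b))=S$. **Universal group of a gga.** Fix a scaffolding. $\mathcal U(\mathcal G)$ is the group of all graph automorphisms $g$ of $\Sigma$ which preserve $\sim$ and $\pi$ and are acceptable: for every $\llbracket v\rrbracket\in VT_\Sigma$ the permutation $g_{\llbracket v\rrbracket}$ of $X(\pi(\llbracket v\rrbracket))$ determined by $g_{\llbracket v\rrbracket}(p(x))=p(g(x))$, $x\in[v]$, lies in $G(\pi(\llbracket v\rrbracket))$. The associated tree is $T_{\mathcal G}=T_\Sigma$, on which $\mathcal U(\mathcal G)$ acts naturally. *)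

theory Defs
  imports
    "Graph_Theory.Arc_Walk"
    "Graph_Theory.Digraph_Component"
    "HOL-Algebra.Group_Action"
begin

section \<open>Graphs with arc reversal, trees, automorphisms\<close>

text \<open>
  The origin and the terminus of an arc are the library's \<^const>\<open>tail\<close> and \<^const>\<open>head\<close>.
  The notions of Graph_Theory are stated for unextended records, which is why
  \<^const>\<open>pre_digraph.truncate\<close> is applied below.
\<close>

record ('a, 'b) rgraph = "('a, 'b) pre_digraph" +
  arev :: "'b \<Rightarrow> 'b"

definition is_graph :: "('a, 'b) rgraph \<Rightarrow> bool" where
  "is_graph \<Gamma> \<longleftrightarrow> wf_digraph (pre_digraph.truncate \<Gamma>) \<and>
     (\<forall>a\<in>arcs \<Gamma>. arev \<Gamma> a \<in> arcs \<Gamma> \<and> arev \<Gamma> (arev \<Gamma> a) = a \<and> tail \<Gamma> a = head \<Gamma> (arev \<Gamma> a))"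

text \<open>
  Because of arc reversal, strong connectedness of the underlying digraph is connectedness.
  It includes that there is at least one vertex.
\<close>

definition is_connected_graph :: "('a, 'b) rgraph \<Rightarrow> bool" where
  "is_connected_graph \<Gamma> \<longleftrightarrow> is_graph \<Gamma> \<and> strongly_connected (pre_digraph.truncate \<Gamma>)"

text \<open>
  An arc followed by its reverse is a cycle of length 2 in the sense of \<^const>\<open>pre_digraph.cycle\<close>,
  hence the bound on the length.
\<close>

definition is_tree :: "('a, 'b) rgraph \<Rightarrow> bool" where
  "is_tree T \<longleftrightarrow> is_connected_graph T \<and>
     loopfree_digraph (pre_digraph.truncate T) \<and>
     nomulti_digraph (pre_digraph.truncate T) \<and>
     (\<nexists>p. pre_digraph.cycle (pre_digraph.truncate T) p \<and> length p \<ge> 3)"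

definition star :: "('a, 'b) rgraph \<Rightarrow> 'a \<Rightarrow> 'b set" where
  "star \<Gamma> v = {a \<in> arcs \<Gamma>. head \<Gamma> a = v}"

text \<open>A morphism is given by its vertex map and its arc map.\<close>

definition graph_hom ::
    "('a, 'b) rgraph \<Rightarrow> ('c, 'd) rgraph \<Rightarrow> ('a \<Rightarrow> 'c) \<Rightarrow> ('b \<Rightarrow> 'd) \<Rightarrow> bool" where
  "graph_hom \<Gamma> \<Gamma>' f h \<longleftrightarrow>
     f \<in> verts \<Gamma> \<rightarrow> verts \<Gamma>' \<and> h \<in> arcs \<Gamma> \<rightarrow> arcs \<Gamma>' \<and>
     (\<forall>a\<in>arcs \<Gamma>. tail \<Gamma>' (h a) = f (tail \<Gamma> a) \<and> head \<Gamma>' (h a) = f (head \<Gamma> a) \<and>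
                 arev \<Gamma>' (h a) = h (arev \<Gamma> a))"

definition graph_iso ::
    "('a, 'b) rgraph \<Rightarrow> ('c, 'd) rgraph \<Rightarrow> ('a \<Rightarrow> 'c) \<Rightarrow> ('b \<Rightarrow> 'd) \<Rightarrow> bool" where
  "graph_iso \<Gamma> \<Gamma>' f h \<longleftrightarrow> graph_hom \<Gamma> \<Gamma>' f h \<and>
     bij_betw f (verts \<Gamma>) (verts \<Gamma>') \<and> bij_betw h (arcs \<Gamma>) (arcs \<Gamma>')"

text \<open>
  As in \<^const>\<open>BijGroup\<close>, permutations are extensional functions.
\<close>

definition aut_group :: "('a, 'b) rgraph \<Rightarrow> (('a \<Rightarrow> 'a) \<times> ('b \<Rightarrow> 'b)) monoid" where
  "aut_group \<Gamma> = (BijGroup (verts \<Gamma>) \<times>\<times> BijGroup (arcs \<Gamma>))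
     \<lparr>carrier := {(f, h). f \<in> Bij (verts \<Gamma>) \<and> h \<in> Bij (arcs \<Gamma>) \<and> graph_hom \<Gamma> \<Gamma> f h}\<rparr>"

section \<open>Actions on trees\<close>

definition faithful_tree_action ::
    "('g, 'm) monoid_scheme \<Rightarrow> ('a, 'b) rgraph \<Rightarrow> ('g \<Rightarrow> ('a \<Rightarrow> 'a) \<times> ('b \<Rightarrow> 'b)) \<Rightarrow> bool" where
  "faithful_tree_action G T \<alpha> \<longleftrightarrow>
     group G \<and> is_tree T \<and> \<alpha> \<in> hom G (aut_group T) \<and> inj_on \<alpha> (carrier G)"

definition isomorphic_tree_actions ::
    "('g, 'm) monoid_scheme \<Rightarrow> ('a, 'b) rgraph \<Rightarrow> ('g \<Rightarrow> ('a \<Rightarrow> 'a) \<times> ('b \<Rightarrow> 'b)) \<Rightarrow>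
     ('h, 'n) monoid_scheme \<Rightarrow> ('c, 'd) rgraph \<Rightarrow> ('h \<Rightarrow> ('c \<Rightarrow> 'c) \<times> ('d \<Rightarrow> 'd)) \<Rightarrow> bool" where
  "isomorphic_tree_actions G T \<alpha> G' T' \<alpha>' \<longleftrightarrow>
     (\<exists>\<phi>\<in>iso G G'. \<exists>f h. graph_iso T T' f h \<and>
        (\<forall>g\<in>carrier G.
           (\<forall>v\<in>verts T. fst (\<alpha>' (\<phi> g)) (f v) = f (fst (\<alpha> g) v)) \<and>
           (\<forall>a\<in>arcs T. snd (\<alpha>' (\<phi> g)) (h a) = h (snd (\<alpha> g) a))))"

text \<open>The given action is isomorphic to that of the group P of automorphisms of T'.\<close>

definition isomorphic_to_aut_action ::
    "('g, 'm) monoid_scheme \<Rightarrow> ('a, 'b) rgraph \<Rightarrow> ('g \<Rightarrow> ('a \<Rightarrow> 'a) \<times> ('b \<Rightarrow> 'b)) \<Rightarrow>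
     (('c \<Rightarrow> 'c) \<times> ('d \<Rightarrow> 'd)) set \<Rightarrow> ('c, 'd) rgraph \<Rightarrow> bool" where
  "isomorphic_to_aut_action G T \<alpha> P T' \<longleftrightarrow>
     isomorphic_tree_actions G T \<alpha> ((aut_group T')\<lparr>carrier := P\<rparr>) T' (\<lambda>g. g)"

section \<open>Local action diagrams\<close>

record ('a, 'b, 'x) local_action_diagram =
  lbase :: "('a, 'b) rgraph"
  lcol :: "'b \<Rightarrow> 'x set"
  lgrp :: "'a \<Rightarrow> ('b \<times> 'x \<Rightarrow> 'b \<times> 'x) set"

text \<open>
  The disjoint union X(v) is formed literally, as a set of pairs; the copy of X(a) in it is
  the product of the singleton of a with X(a).
\<close>

definition lad_colours :: "('a, 'b, 'x) local_action_diagram \<Rightarrow> 'a \<Rightarrow> ('b \<times> 'x) set" where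
  "lad_colours D v = (SIGMA a : star (lbase D) v. lcol D a)"

definition is_lad :: "('a, 'b, 'x) local_action_diagram \<Rightarrow> bool" where
  "is_lad D \<longleftrightarrow> is_connected_graph (lbase D) \<and>
     (\<forall>v\<in>verts (lbase D). subgroup (lgrp D v) (BijGroup (lad_colours D v)) \<and>
        (\<forall>a\<in>star (lbase D) v. {a} \<times> lcol D a \<in>
           orbits ((BijGroup (lad_colours D v))\<lparr>carrier := lgrp D v\<rparr>) (lad_colours D v) (\<lambda>g. g)))"

record ('c, 'd, 'a, 'b, 'x) labelled_tree =
  ltree :: "('c, 'd) rgraph"
  lproj_v :: "'c \<Rightarrow> 'a"
  lproj_a :: "'d \<Rightarrow> 'b"
  llab :: "'d \<Rightarrow> 'b \<times> 'x"

definition is_associated_tree ::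
    "('a, 'b, 'x) local_action_diagram \<Rightarrow> ('c, 'd, 'a, 'b, 'x) labelled_tree \<Rightarrow> bool" where
  "is_associated_tree D A \<longleftrightarrow> is_tree (ltree A) \<and>
     graph_hom (ltree A) (lbase D) (lproj_v A) (lproj_a A) \<and>
     lproj_v A ` verts (ltree A) = verts (lbase D) \<and>
     lproj_a A ` arcs (ltree A) = arcs (lbase D) \<and>
     (\<forall>v\<in>verts (ltree A). \<forall>a\<in>arcs (lbase D). head (lbase D) a = lproj_v A v \<longrightarrow>
        bij_betw (llab A) {b \<in> star (ltree A) v. lproj_a A b = a} ({a} \<times> lcol D a))"

text \<open>
  For an automorphism with arc map h, the local action at v is the conjugate of h by the
  labellings of the stars of v and of its image (both labellings are restrictions of L).
\<close>

definition lad_local_action ::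
    "('a, 'b, 'x) local_action_diagram \<Rightarrow> ('c, 'd, 'a, 'b, 'x) labelled_tree \<Rightarrow>
     ('d \<Rightarrow> 'd) \<Rightarrow> 'c \<Rightarrow> 'b \<times> 'x \<Rightarrow> 'b \<times> 'x" where
  "lad_local_action D A h v =
     (\<lambda>x\<in>lad_colours D (lproj_v A v). llab A (h (inv_into (star (ltree A) v) (llab A) x)))"

definition lad_universal_group ::
    "('a, 'b, 'x) local_action_diagram \<Rightarrow> ('c, 'd, 'a, 'b, 'x) labelled_tree \<Rightarrow>
     (('c \<Rightarrow> 'c) \<times> ('d \<Rightarrow> 'd)) set" where
  "lad_universal_group D A = {(f, h) \<in> carrier (aut_group (ltree A)).
     (\<forall>v\<in>verts (ltree A). lproj_v A (f v) = lproj_v A v) \<and>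
     (\<forall>b\<in>arcs (ltree A). lproj_a A (h b) = lproj_a A b) \<and>
     (\<forall>v\<in>verts (ltree A). lad_local_action D A h v \<in> lgrp D (lproj_v A v))}"

section \<open>Graphs of group actions\<close>

definition perm_group_action :: "('x \<Rightarrow> 'x) set \<Rightarrow> 'x set \<Rightarrow> bool" where
  "perm_group_action G X \<longleftrightarrow> X \<noteq> {} \<and> subgroup G (BijGroup X)"

definition induced_perms :: "('x \<Rightarrow> 'x) set \<Rightarrow> 'x set \<Rightarrow> ('x \<Rightarrow> 'x) set" where
  "induced_perms G Y = {restrict g Y | g. g \<in> G \<and> g ` Y = Y}"

definition action_embedding ::
    "('y \<Rightarrow> 'x) \<Rightarrow> ('y \<Rightarrow> 'y) set \<Rightarrow> 'y set \<Rightarrow> ('x \<Rightarrow> 'x) set \<Rightarrow> 'x set \<Rightarrow> bool" where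
  "action_embedding \<Phi> H Y G X \<longleftrightarrow> \<Phi> \<in> Y \<rightarrow> X \<and> inj_on \<Phi> Y \<and>
     (\<lambda>h. \<lambda>x\<in>\<Phi> ` Y. \<Phi> (h (inv_into Y \<Phi> x))) \<in>
       iso ((BijGroup Y)\<lparr>carrier := H\<rparr>)
           ((BijGroup (\<Phi> ` Y))\<lparr>carrier := induced_perms G (\<Phi> ` Y)\<rparr>)"

record ('a, 'b, 'x, 'y) gga =
  gbase :: "('a, 'b) rgraph"
  gvset :: "'a \<Rightarrow> 'x set"
  gvgrp :: "'a \<Rightarrow> ('x \<Rightarrow> 'x) set"
  gaset :: "'b \<Rightarrow> 'y set"
  gagrp :: "'b \<Rightarrow> ('y \<Rightarrow> 'y) set"
  gemb :: "'b \<Rightarrow> 'y \<Rightarrow> 'x"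
  gtwist :: "'b \<Rightarrow> 'y \<Rightarrow> 'y"

text \<open>Only the values of \<^const>\<open>gtwist\<close> at self-reverse arcs are relevant.\<close>

definition is_gga :: "('a, 'b, 'x, 'y) gga \<Rightarrow> bool" where
  "is_gga \<G> \<longleftrightarrow> is_connected_graph (gbase \<G>) \<and>
     (\<forall>v\<in>verts (gbase \<G>). perm_group_action (gvgrp \<G> v) (gvset \<G> v)) \<and>
     (\<forall>a\<in>arcs (gbase \<G>).
        perm_group_action (gagrp \<G> a) (gaset \<G> a) \<and>
        gaset \<G> (arev (gbase \<G>) a) = gaset \<G> a \<and>
        gagrp \<G> (arev (gbase \<G>) a) = gagrp \<G> a \<and>
        action_embedding (gemb \<G> a) (gagrp \<G> a) (gaset \<G> a)
          (gvgrp \<G> (head (gbase \<G>) a)) (gvset \<G> (head (gbase \<G>) a)) \<and>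
        (arev (gbase \<G>) a = a \<longrightarrow>
           (let S = BijGroup (gaset \<G> a); k = gtwist \<G> a in
              k \<in> carrier S \<and>
              {k \<otimes>\<^bsub>S\<^esub> h \<otimes>\<^bsub>S\<^esub> inv\<^bsub>S\<^esub> k | h. h \<in> gagrp \<G> a} = gagrp \<G> a \<and>
              k \<otimes>\<^bsub>S\<^esub> k \<in> gagrp \<G> a)))"

definition is_free_gga :: "('a, 'b, 'x, 'y) gga \<Rightarrow> bool" where
  "is_free_gga \<G> \<longleftrightarrow> is_gga \<G> \<and>
     (\<forall>a\<in>arcs (gbase \<G>). (\<exists>y. gaset \<G> a = {y}) \<and> gagrp \<G> a = {\<one>\<^bsub>BijGroup (gaset \<G> a)\<^esub>})"

text \<open>Adhesion maps are taken as extensional functions on Y(a).\<close>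

definition adhesion_maps :: "('a, 'b, 'x, 'y) gga \<Rightarrow> 'b \<Rightarrow> ('y \<Rightarrow> 'x) set" where
  "adhesion_maps \<G> a =
     {(\<lambda>y\<in>gaset \<G> a. g (gemb \<G> a y)) | g. g \<in> gvgrp \<G> (head (gbase \<G>) a)}"

definition twisted_adhesion_maps :: "('a, 'b, 'x, 'y) gga \<Rightarrow> 'b \<Rightarrow> ('y \<Rightarrow> 'x) set" where
  "twisted_adhesion_maps \<G> a =
     {(\<lambda>y\<in>gaset \<G> a. g (gemb \<G> a (gtwist \<G> a y))) | g. g \<in> gvgrp \<G> (head (gbase \<G>) a)}"

definition adhesion_sets :: "('a, 'b, 'x, 'y) gga \<Rightarrow> 'b \<Rightarrow> 'x set set" where
  "adhesion_sets \<G> a = (\<lambda>\<psi>. \<psi> ` gaset \<G> a) ` adhesion_maps \<G> a"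

section \<open>Scaffoldings\<close>

definition arc_rel :: "('s, 'e) rgraph \<Rightarrow> ('s \<times> 's) set \<Rightarrow> ('e \<times> 'e) set" where
  "arc_rel \<Sigma> R = {(a, a'). a \<in> arcs \<Sigma> \<and> a' \<in> arcs \<Sigma> \<and>
     (tail \<Sigma> a, tail \<Sigma> a') \<in> R \<and> (head \<Sigma> a, head \<Sigma> a') \<in> R}"

text \<open>
  For an equivalence relation R on the vertices, all arcs in a class C have tails (and heads) in
  one vertex class, and the reverses of the arcs in C form an arc class.
\<close>

definition quotient_graph :: "('s, 'e) rgraph \<Rightarrow> ('s \<times> 's) set \<Rightarrow> ('s set, 'e set) rgraph" where
  "quotient_graph \<Sigma> R =
     \<lparr>verts = verts \<Sigma> // R,
      arcs = arcs \<Sigma> // arc_rel \<Sigma> R,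
      tail = (\<lambda>C. R `` (tail \<Sigma> ` C)),
      head = (\<lambda>C. R `` (head \<Sigma> ` C)),
      arev = (\<lambda>C. arev \<Sigma> ` C)\<rparr>"

text \<open>The maps \<pi> and p are split into their vertex and arc parts.\<close>

record ('s, 'e, 'a, 'b, 'x, 'y) scaffolding =
  sgraph :: "('s, 'e) rgraph"
  srel :: "('s \<times> 's) set"
  sproj_v :: "'s set \<Rightarrow> 'a"
  sproj_a :: "'e set \<Rightarrow> 'b"
  scol_v :: "'s \<Rightarrow> 'x"
  scol_a :: "'e \<Rightarrow> 'y"

definition scaf_tree :: "('s, 'e, 'a, 'b, 'x, 'y) scaffolding \<Rightarrow> ('s set, 'e set) rgraph" where
  "scaf_tree S = quotient_graph (sgraph S) (srel S)"

text \<open>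
  \<Psi> for an arc C of the quotient: a colour y is sent to the colour of the terminus of the arc
  in C which has colour y.
\<close>

definition scaf_psi ::
    "('a, 'b, 'x, 'y) gga \<Rightarrow> ('s, 'e, 'a, 'b, 'x, 'y) scaffolding \<Rightarrow> 'e set \<Rightarrow> 'y \<Rightarrow> 'x" where
  "scaf_psi \<G> S C =
     (\<lambda>y\<in>gaset \<G> (sproj_a S C). scol_v S (head (sgraph S) (inv_into C (scol_a S) y)))"

definition legal_colouring ::
    "('a, 'b, 'x, 'y) gga \<Rightarrow> ('s, 'e, 'a, 'b, 'x, 'y) scaffolding \<Rightarrow> bool" where
  "legal_colouring \<G> S \<longleftrightarrow>
     (\<forall>C\<in>verts (scaf_tree S). bij_betw (scol_v S) C (gvset \<G> (sproj_v S C))) \<and>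
     (\<forall>C\<in>arcs (scaf_tree S). bij_betw (scol_a S) C (gaset \<G> (sproj_a S C))) \<and>
     (\<forall>b\<in>arcs (sgraph S). scol_a S (arev (sgraph S) b) = scol_a S b) \<and>
     (\<forall>C\<in>arcs (scaf_tree S).
        let a = sproj_a S C; \<psi> = scaf_psi \<G> S C;
            \<psi>' = scaf_psi \<G> S (arev (scaf_tree S) C) in
        if arev (gbase \<G>) a \<noteq> a then \<psi> \<in> adhesion_maps \<G> a
        else \<psi> \<in> adhesion_maps \<G> a \<and> \<psi>' \<in> twisted_adhesion_maps \<G> a \<or>
             \<psi>' \<in> adhesion_maps \<G> a \<and> \<psi> \<in> twisted_adhesion_maps \<G> a) \<and>
     (\<forall>C\<in>verts (scaf_tree S). \<forall>b\<in>star (gbase \<G>) (sproj_v S C). \<forall>Z\<in>adhesion_sets \<G> b.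
        \<exists>!E. E \<in> star (scaf_tree S) C \<and> sproj_a S E = b \<and> scaf_psi \<G> S E ` gaset \<G> b = Z)"

definition is_scaffolding ::
    "('a, 'b, 'x, 'y) gga \<Rightarrow> ('s, 'e, 'a, 'b, 'x, 'y) scaffolding \<Rightarrow> bool" where
  "is_scaffolding \<G> S \<longleftrightarrow> is_graph (sgraph S) \<and> equiv (verts (sgraph S)) (srel S) \<and>
     is_tree (scaf_tree S) \<and>
     (\<forall>a\<in>arcs (sgraph S). (tail (sgraph S) a, head (sgraph S) a) \<notin> srel S) \<and>
     graph_hom (scaf_tree S) (gbase \<G>) (sproj_v S) (sproj_a S) \<and>
     legal_colouring \<G> S"

section \<open>The universal group of a graph of group actions\<close>

definition gga_local_action ::
    "('a, 'b, 'x, 'y) gga \<Rightarrow> ('s, 'e, 'a, 'b, 'x, 'y) scaffolding \<Rightarrow>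
     ('s \<Rightarrow> 's) \<Rightarrow> 's set \<Rightarrow> 'x \<Rightarrow> 'x" where
  "gga_local_action \<G> S f C =
     (\<lambda>x\<in>gvset \<G> (sproj_v S C). scol_v S (f (inv_into C (scol_v S) x)))"

definition gga_universal_group ::
    "('a, 'b, 'x, 'y) gga \<Rightarrow> ('s, 'e, 'a, 'b, 'x, 'y) scaffolding \<Rightarrow>
     (('s \<Rightarrow> 's) \<times> ('e \<Rightarrow> 'e)) set" where
  "gga_universal_group \<G> S = {(f, h) \<in> carrier (aut_group (sgraph S)).
     (\<forall>x\<in>verts (sgraph S). \<forall>y\<in>verts (sgraph S). (f x, f y) \<in> srel S \<longleftrightarrow> (x, y) \<in> srel S) \<and>
     (\<forall>C\<in>verts (scaf_tree S). sproj_v S (f ` C) = sproj_v S C) \<and>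
     (\<forall>C\<in>arcs (scaf_tree S). sproj_a S (h ` C) = sproj_a S C) \<and>
     (\<forall>C\<in>verts (scaf_tree S). gga_local_action \<G> S f C \<in> gvgrp \<G> (sproj_v S C))}"

text \<open>
  The action of the universal group on its tree need not be faithful; this is the group of
  permutations of the tree which it induces.
\<close>

definition gga_induced_group ::
    "('a, 'b, 'x, 'y) gga \<Rightarrow> ('s, 'e, 'a, 'b, 'x, 'y) scaffolding \<Rightarrow>
     (('s set \<Rightarrow> 's set) \<times> ('e set \<Rightarrow> 'e set)) set" where
  "gga_induced_group \<G> S =
     (\<lambda>(f, h). (\<lambda>C\<in>verts (scaf_tree S). f ` C, \<lambda>C\<in>arcs (scaf_tree S). h ` C))
       ` gga_universal_group \<G> S"

section \<open>Size of the existentially quantified structures\<close>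

text \<open>
  HOL cannot quantify existentially over types.  Diagrams, graphs of group actions and
  scaffoldings are therefore taken with all their underlying sets in one type, which contains
  the vertices (type 'v) and the arcs (type 'e) of the given tree, plus an arbitrary type 'u.
  As 'u is a free type variable, structures of arbitrary size are covered.
\<close>

type_synonym ('v, 'e, 'u) univ = "'v + 'e + 'u"

type_synonym 'w lad_in = "('w, 'w, 'w) local_action_diagram"
type_synonym 'w tree_in = "('w, 'w, 'w, 'w, 'w) labelled_tree"
type_synonym 'w gga_in = "('w, 'w, 'w, 'w) gga"
type_synonym 'w scaffolding_in = "('w, 'w, 'w, 'w, 'w, 'w) scaffolding"

end

(*
Since the sets Y(a) of a free graph of group actions are singletons, an a-adhesion map is a point
of X(t(a)), and the a-adhesion sets form one orbit of G(t(a)). Taking these orbits as the colour sets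
X(a) turns the graph of group actions into a local action diagram; points of X(v) lying on no
adhesion set and coincidences of orbits of different arcs do not matter, because an automorphism of
the tree with permissible local actions at the arcs can be lifted to the scaffolding class by class.
Conversely a diagram whose colour sets are pairwise disjoint becomes a free graph of group actions
with X(v) the union of the X(a) and one more point.
*)

theory Submission
  imports Defs "Graph_Theory.Digraph_Isomorphism"
begin

section \<open>Graph isomorphisms\<close>

text \<open>Two obstacles shape the proof. A scaffolding may have points that are the end of no arc,
  and its universal group need not act faithfully on the tree, so the lift of a tree automorphism is
  a matter of choice. The choices in different classes are independent because freeness makes every
  class of arcs a single arc: its end is determined by a class and a colour, and nothing else links
  neighbouring classes. The second obstacle is that the structures must be found in a prescribed
  type. Every diagram is therefore rebuilt from pieces of its own tree, with tree arcs as colours.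
  This also supplies pairwise disjoint colour sets and leaves the tree vertices free to serve as the
  additional point. For the graph of group actions built from a diagram, the universal group is not
  computed from its definition. The diagram attached to it agrees with the original one on the base
  graph, so the comparison that holds for all free graphs of group actions applies.\<close>

lemma truncate_sel [simp]:
  "verts (pre_digraph.truncate \<Gamma>) = verts \<Gamma>"
  "arcs (pre_digraph.truncate \<Gamma>) = arcs \<Gamma>"
  "tail (pre_digraph.truncate \<Gamma>) = tail \<Gamma>"
  "head (pre_digraph.truncate \<Gamma>) = head \<Gamma>"
  by (simp_all add: pre_digraph.truncate_def)

lemma is_graph_iff:
  "is_graph \<Gamma> \<longleftrightarrow> (\<forall>a\<in>arcs \<Gamma>. tail \<Gamma> a \<in> verts \<Gamma> \<and> head \<Gamma> a \<in> verts \<Gamma> \<and>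
     arev \<Gamma> a \<in> arcs \<Gamma> \<and> arev \<Gamma> (arev \<Gamma> a) = a \<and> tail \<Gamma> a = head \<Gamma> (arev \<Gamma> a))"
  by (auto simp: is_graph_def wf_digraph_def)

lemma is_graphD:
  assumes "is_graph \<Gamma>" "a \<in> arcs \<Gamma>"
  shows "tail \<Gamma> a \<in> verts \<Gamma>" "head \<Gamma> a \<in> verts \<Gamma>" "arev \<Gamma> a \<in> arcs \<Gamma>"
    "arev \<Gamma> (arev \<Gamma> a) = a" "head \<Gamma> (arev \<Gamma> a) = tail \<Gamma> a" "tail \<Gamma> (arev \<Gamma> a) = head \<Gamma> a"
  using assms by (auto simp: is_graph_iff)

lemma is_treeD:
  assumes "is_tree T"
  shows "is_connected_graph T" "is_graph T" "verts T \<noteq> {}"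
    "\<And>a. a \<in> arcs T \<Longrightarrow> tail T a \<noteq> head T a"
    "\<And>a b. \<lbrakk>a \<in> arcs T; b \<in> arcs T; tail T a = tail T b; head T a = head T b\<rbrakk> \<Longrightarrow> a = b"
  using assms
  by (auto simp: is_tree_def is_connected_graph_def strongly_connected_def
      loopfree_digraph_def loopfree_digraph_axioms_def nomulti_digraph_def
      nomulti_digraph_axioms_def arc_to_ends_def)

lemma graph_homD:
  assumes "graph_hom \<Gamma> \<Gamma>' f h"
  shows "v \<in> verts \<Gamma> \<Longrightarrow> f v \<in> verts \<Gamma>'" "a \<in> arcs \<Gamma> \<Longrightarrow> h a \<in> arcs \<Gamma>'"
    "a \<in> arcs \<Gamma> \<Longrightarrow> tail \<Gamma>' (h a) = f (tail \<Gamma> a)" "a \<in> arcs \<Gamma> \<Longrightarrow> head \<Gamma>' (h a) = f (head \<Gamma> a)"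
    "a \<in> arcs \<Gamma> \<Longrightarrow> arev \<Gamma>' (h a) = h (arev \<Gamma> a)"
  using assms by (auto simp: graph_hom_def)

lemma graph_isoD:
  assumes "graph_iso \<Gamma> \<Gamma>' f h"
  shows "graph_hom \<Gamma> \<Gamma>' f h" "bij_betw f (verts \<Gamma>) (verts \<Gamma>')" "bij_betw h (arcs \<Gamma>) (arcs \<Gamma>')"
    "inj_on f (verts \<Gamma>)" "inj_on h (arcs \<Gamma>)" "f ` verts \<Gamma> = verts \<Gamma>'" "h ` arcs \<Gamma> = arcs \<Gamma>'"
  using assms by (auto simp: graph_iso_def bij_betw_def)

lemma graph_iso_is_graph:
  assumes "is_graph \<Gamma>" "graph_iso \<Gamma> \<Gamma>' f h"
  shows "is_graph \<Gamma>'"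
proof -
  note i = graph_isoD[OF assms(2)]
  show ?thesis
    unfolding is_graph_iff i(7)[symmetric] i(6)[symmetric]
    by (auto simp: graph_homD[OF i(1)] is_graphD[OF assms(1)])
qed

lemma graph_iso_trans:
  assumes "graph_iso \<Gamma> \<Gamma>' f h" "graph_iso \<Gamma>' \<Gamma>'' f' h'"
  shows "graph_iso \<Gamma> \<Gamma>'' (f' \<circ> f) (h' \<circ> h)"
  using assms unfolding graph_iso_def
  by (auto intro: bij_betw_trans simp: graph_hom_def Pi_iff)

lemma graph_iso_inv:
  assumes "is_graph \<Gamma>" "graph_iso \<Gamma> \<Gamma>' f h"
  shows "graph_iso \<Gamma>' \<Gamma> (inv_into (verts \<Gamma>) f) (inv_into (arcs \<Gamma>) h)"
proof -
  note i = graph_isoD[OF assms(2)]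
  have "graph_hom \<Gamma>' \<Gamma> (inv_into (verts \<Gamma>) f) (inv_into (arcs \<Gamma>) h)"
    unfolding graph_hom_def i(7)[symmetric] i(6)[symmetric]
    by (auto simp: graph_homD[OF i(1)] is_graphD[OF assms(1)] i(4,5))
  with i show ?thesis
    by (simp add: graph_iso_def bij_betw_inv_into)
qed

text \<open>Gives access to the known transport of walks and reachability along digraph
  isomorphisms. The components \<open>iso_head\<close> and \<open>iso_tail\<close> are the total
  functions of \<open>\<Gamma>'\<close>, so that \<open>app_iso\<close> yields an equation of graphs
  and not just agreement on arcs.\<close>

lemma graph_iso_digraph_isomorphism:
  assumes "is_graph \<Gamma>" "graph_iso \<Gamma> \<Gamma>' f h"
  defines "m \<equiv> \<lparr>iso_verts = f, iso_arcs = h, iso_head = head \<Gamma>', iso_tail = tail \<Gamma>'\<rparr>"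
  shows "pre_digraph.digraph_isomorphism (pre_digraph.truncate \<Gamma>) m"
    "app_iso m (pre_digraph.truncate \<Gamma>) = pre_digraph.truncate \<Gamma>'"
proof -
  note i = graph_isoD[OF assms(2)]
  show "pre_digraph.digraph_isomorphism (pre_digraph.truncate \<Gamma>) m"
    using assms(1) i by (auto simp: pre_digraph.digraph_isomorphism_def is_graph_def m_def graph_homD[OF i(1)])
  show "app_iso m (pre_digraph.truncate \<Gamma>) = pre_digraph.truncate \<Gamma>'"
    using i by (simp add: app_iso_def m_def pre_digraph.truncate_def)
qed

lemma graph_iso_is_connected_graph:
  assumes "is_connected_graph \<Gamma>" "graph_iso \<Gamma> \<Gamma>' f h"
  shows "is_connected_graph \<Gamma>'"
proof -
  have g: "is_graph \<Gamma>" and wf: "wf_digraph (pre_digraph.truncate \<Gamma>)"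
    and sc: "strongly_connected (pre_digraph.truncate \<Gamma>)"
    using assms(1) by (auto simp: is_connected_graph_def is_graph_def)
  note m = graph_iso_digraph_isomorphism[OF g assms(2)]
  note i = graph_isoD[OF assms(2)]
  have "strongly_connected (pre_digraph.truncate \<Gamma>')"
    using sc wf_digraph.reachableI_app_iso[OF wf _ m(1)] unfolding m(2)
    by (auto simp: strongly_connected_def simp flip: i(6))
  then show ?thesis
    using graph_iso_is_graph[OF g assms(2)] by (simp add: is_connected_graph_def)
qed

lemma graph_iso_is_tree:
  assumes "is_tree T" "graph_iso T T' f h"
  shows "is_tree T'"
proof -
  note t = is_treeD[OF assms(1)]
  note i = graph_isoD[OF assms(2)]
  have g': "is_graph T'"
    using graph_iso_is_graph[OF t(2) assms(2)] .
  then have wf': "wf_digraph (pre_digraph.truncate T')" and wf: "wf_digraph (pre_digraph.truncate T)"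
    using t(2) by (auto simp: is_graph_def)
  note m = graph_iso_digraph_isomorphism[OF t(2) assms(2)]
  let ?m = "\<lparr>iso_verts = f, iso_arcs = h, iso_head = head T', iso_tail = tail T'\<rparr>"
  have lf: "loopfree_digraph (pre_digraph.truncate T')"
    using wf' t(2,4) i(4)
    by (auto simp: loopfree_digraph_def loopfree_digraph_axioms_def graph_homD[OF i(1)] is_graphD
        inj_on_eq_iff simp flip: i(7))
  have nm: "nomulti_digraph (pre_digraph.truncate T')"
    using wf' t(2,5) i(4)
    by (auto simp: nomulti_digraph_def nomulti_digraph_axioms_def arc_to_ends_def graph_homD[OF i(1)]
        is_graphD inj_on_eq_iff intro!: arg_cong[where f = h] t(5) simp flip: i(7))
  \<comment> \<open>A cycle of \<open>T'\<close> is pulled back arc by arc to a closed walk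
    \<open>q\<close> of \<open>T\<close> of the same length; its vertices after the first are
    distinct because their images under \<open>f\<close> are.\<close>
  have "length p < 3" if "pre_digraph.cycle (pre_digraph.truncate T') p" for p
  proof -
    obtain u where u: "pre_digraph.awalk (pre_digraph.truncate T') u p u"
      "distinct (tl (pre_digraph.awalk_verts (pre_digraph.truncate T') u p))" "p \<noteq> []"
      using \<open>pre_digraph.cycle (pre_digraph.truncate T') p\<close> by (auto simp: pre_digraph.cycle_def)
    define k where "k = pre_digraph.inv_iso (pre_digraph.truncate T) ?m"
    define q where "q = map (iso_arcs k) p"
    have aw: "pre_digraph.awalk (pre_digraph.truncate T) (iso_verts k u) q (iso_verts k u)"
      unfolding k_def q_def by (rule wf_digraph.awalk_app_isoD[OF wf _ m(1)]) (simp add: m(2) u)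
    have fu: "f (iso_verts k u) = u" and hq: "map h q = p"
    proof -
      have "u \<in> verts T'" "set p \<subseteq> arcs T'"
        using u(1) by (auto simp: pre_digraph.awalk_def)
      then show "f (iso_verts k u) = u" "map h q = p"
        using pre_digraph.iso_verts_iso_inv[OF m(1), of u] pre_digraph.iso_arcs_iso_inv[OF m(1)]
        unfolding m(2) by (auto simp: k_def q_def intro!: map_idI)
    qed
    have "pre_digraph.awalk_verts (pre_digraph.truncate T') u p =
        map f (pre_digraph.awalk_verts (pre_digraph.truncate T) (iso_verts k u) q)"
      using wf_digraph.awalk_verts_app_iso_eq[OF wf m(1) aw] unfolding m(2) by (simp add: fu hq)
    then have "distinct (tl (pre_digraph.awalk_verts (pre_digraph.truncate T) (iso_verts k u) q))"
      using u(2) by (simp add: distinct_map map_tl[symmetric])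
    then have "pre_digraph.cycle (pre_digraph.truncate T) q"
      using aw u(3) by (auto simp: pre_digraph.cycle_def q_def)
    then have "\<not> length q \<ge> 3"
      using assms(1) by (auto simp: is_tree_def)
    then show ?thesis by (simp add: q_def)
  qed
  then have "\<nexists>p. pre_digraph.cycle (pre_digraph.truncate T') p \<and> length p \<ge> 3"
    by (meson not_le)
  then show ?thesis
    using lf nm graph_iso_is_connected_graph[OF t(1) assms(2)] by (simp add: is_tree_def)
qed

definition map_graph :: "('a \<Rightarrow> 'c) \<Rightarrow> ('b \<Rightarrow> 'd) \<Rightarrow> ('a, 'b) rgraph \<Rightarrow> ('c, 'd) rgraph" where
  "map_graph f h \<Gamma> =
     \<lparr>verts = f ` verts \<Gamma>, arcs = h ` arcs \<Gamma>,
      tail = (\<lambda>b. f (tail \<Gamma> (inv_into (arcs \<Gamma>) h b))),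
      head = (\<lambda>b. f (head \<Gamma> (inv_into (arcs \<Gamma>) h b))),
      arev = (\<lambda>b. h (arev \<Gamma> (inv_into (arcs \<Gamma>) h b)))\<rparr>"

lemma graph_iso_map_graph:
  assumes "inj_on f (verts \<Gamma>)" "inj_on h (arcs \<Gamma>)"
  shows "graph_iso \<Gamma> (map_graph f h \<Gamma>) f h"
  using assms by (auto simp: graph_iso_def graph_hom_def map_graph_def bij_betw_def)

lemma graph_iso_star:
  assumes "is_graph \<Gamma>" "graph_iso \<Gamma> \<Gamma>' f h" "v \<in> verts \<Gamma>"
  shows "star \<Gamma>' (f v) = h ` star \<Gamma> v"
proof -
  note i = graph_isoD[OF assms(2)]
  show ?thesis
    using inj_onD[OF i(4)] assms(3)
    by (auto simp: star_def graph_homD[OF i(1)] is_graphD[OF assms(1)] simp flip: i(7))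
qed

section \<open>Transport of permutations\<close>

text \<open>One construction for two purposes: conjugation when \<open>e\<close> maps
  \<open>S\<close> onto \<open>S'\<close>, as in a renaming, and extension by fixed points when
  \<open>S'\<close> is larger, as for the additional point of a graph of group actions.\<close>

definition extend_perm :: "('a \<Rightarrow> 'b) \<Rightarrow> 'a set \<Rightarrow> 'b set \<Rightarrow> ('a \<Rightarrow> 'a) \<Rightarrow> 'b \<Rightarrow> 'b" where
  "extend_perm e S S' g = (\<lambda>y\<in>S'. if y \<in> e ` S then e (g (inv_into S e y)) else y)"

lemma Bij_iff: "g \<in> Bij S \<longleftrightarrow> g \<in> extensional S \<and> inj_on g S \<and> g ` S = S"
  by (auto simp: Bij_def bij_betw_def)

lemma Bij_mem: "\<lbrakk>g \<in> Bij S; x \<in> S\<rbrakk> \<Longrightarrow> g x \<in> S"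
  by (auto simp: Bij_iff)

lemma carrier_BijGroup [simp]: "carrier (BijGroup S) = Bij S"
  by (simp add: BijGroup_def)

lemma mult_BijGroup: "\<lbrakk>g \<in> Bij S; k \<in> Bij S\<rbrakk> \<Longrightarrow> g \<otimes>\<^bsub>BijGroup S\<^esub> k = compose S g k"
  by (simp add: BijGroup_def)

lemma one_BijGroup: "\<one>\<^bsub>BijGroup S\<^esub> = (\<lambda>x\<in>S. x)"
  by (simp add: BijGroup_def)

lemma subgroup_BijGroup_mem: "\<lbrakk>subgroup H (BijGroup S); g \<in> H\<rbrakk> \<Longrightarrow> g \<in> Bij S"
  using subgroup.mem_carrier[of H "BijGroup S" g] by simp

lemma Bij_ext: "\<lbrakk>g \<in> Bij S; k \<in> Bij S; \<And>x. x \<in> S \<Longrightarrow> g x = k x\<rbrakk> \<Longrightarrow> g = k"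
  by (auto simp: Bij_iff intro: extensionalityI)

lemma extend_perm_apply: "\<lbrakk>inj_on e S; e ` S \<subseteq> S'; x \<in> S\<rbrakk> \<Longrightarrow> extend_perm e S S' g (e x) = e (g x)"
  by (auto simp: extend_perm_def)

lemma extend_perm_fixed: "\<lbrakk>y \<in> S'; y \<notin> e ` S\<rbrakk> \<Longrightarrow> extend_perm e S S' g y = y"
  by (simp add: extend_perm_def)

lemma extend_perm_Bij:
  assumes "inj_on e S" "e ` S \<subseteq> S'" "g \<in> Bij S"
  shows "extend_perm e S S' g \<in> Bij S'"
proof -
  let ?g = "extend_perm e S S' g"
  \<comment> \<open>The image of \<open>e\<close> and its complement are each preserved, so
    bijectivity can be checked on the two pieces.\<close>
  have 1: "?g ` (e ` S) = e ` S"
  proof -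
    have "?g ` (e ` S) = e ` g ` S"
      by (auto simp: image_image extend_perm_apply[OF assms(1,2)])
    then show ?thesis using assms(3) by (simp add: Bij_iff)
  qed
  have 2: "?g ` (S' - e ` S) = S' - e ` S"
    by (auto simp: extend_perm_fixed)
  have "inj_on ?g (e ` S)"
  proof (rule inj_onI)
    fix u v assume "u \<in> e ` S" "v \<in> e ` S" and uv: "?g u = ?g v"
    then obtain x y where x: "x \<in> S" "u = e x" and y: "y \<in> S" "v = e y" by auto
    then have "e (g x) = e (g y)"
      using uv by (simp add: extend_perm_apply[OF assms(1,2)])
    then have "g x = g y"
      using inj_on_eq_iff[OF assms(1), of "g x" "g y"] Bij_mem[OF assms(3)] x y by simp
    then show "u = v"
      using x y assms(3) by (auto simp: Bij_iff dest: inj_onD)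
  qed
  moreover have "inj_on ?g (S' - e ` S)"
    by (auto simp: inj_on_def extend_perm_fixed)
  ultimately have "inj_on ?g (e ` S \<union> (S' - e ` S))"
    unfolding inj_on_Un using 1 2 by auto
  moreover have "e ` S \<union> (S' - e ` S) = S'" using assms(2) by auto
  moreover have "?g ` (e ` S \<union> (S' - e ` S)) = e ` S \<union> (S' - e ` S)"
    unfolding image_Un 1 2 ..
  moreover have "?g \<in> extensional S'" by (simp add: extend_perm_def)
  ultimately show ?thesis
    by (simp add: Bij_iff)
qed

lemma extend_perm_compose:
  assumes "inj_on e S" "e ` S \<subseteq> S'" "g \<in> Bij S" "k \<in> Bij S"
  shows "extend_perm e S S' (compose S g k) = compose S' (extend_perm e S S' g) (extend_perm e S S' k)"
proof (rule Bij_ext)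
  show "extend_perm e S S' (compose S g k) \<in> Bij S'"
    "compose S' (extend_perm e S S' g) (extend_perm e S S' k) \<in> Bij S'"
    using assms by (simp_all add: extend_perm_Bij compose_Bij)
next
  fix y assume y: "y \<in> S'"
  show "extend_perm e S S' (compose S g k) y = compose S' (extend_perm e S S' g) (extend_perm e S S' k) y"
  proof (cases "y \<in> e ` S")
    case True
    then obtain x where "x \<in> S" "y = e x" by auto
    with y assms show ?thesis
      by (simp add: compose_def extend_perm_apply Bij_mem)
  next
    case False
    with y show ?thesis by (simp add: compose_def extend_perm_fixed)
  qed
qed

lemma extend_perm_hom:
  "\<lbrakk>inj_on e S; e ` S \<subseteq> S'\<rbrakk> \<Longrightarrow> extend_perm e S S' \<in> hom (BijGroup S) (BijGroup S')"
  by (auto intro!: homI simp: extend_perm_Bij mult_BijGroup extend_perm_compose)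

lemma subgroup_hom_image:
  assumes "k \<in> hom (BijGroup S) (BijGroup S')" "subgroup H (BijGroup S)"
  shows "subgroup (k ` H) (BijGroup S')"
proof -
  interpret group_hom "BijGroup S" "BijGroup S'" k
    using assms(1) by (simp add: group_hom_def group_hom_axioms_def group_BijGroup)
  show ?thesis by (rule subgroup_img_is_subgroup[OF assms(2)])
qed

lemma inj_on_extend_perm:
  assumes "inj_on e S" "e ` S \<subseteq> S'"
  shows "inj_on (extend_perm e S S') (Bij S)"
proof (rule inj_onI)
  fix g k assume g: "g \<in> Bij S" and k: "k \<in> Bij S" and eq: "extend_perm e S S' g = extend_perm e S S' k"
  show "g = k"
  proof (rule Bij_ext[OF g k])
    fix x assume "x \<in> S"
    then have "e (g x) = e (k x)"
      using extend_perm_apply[OF assms, of x g] extend_perm_apply[OF assms, of x k] eq by simp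
    then show "g x = k x"
      using assms(1) g k \<open>x \<in> S\<close> by (auto simp: inj_on_eq_iff Bij_mem)
  qed
qed

lemma extend_perm_id: "g \<in> Bij S \<Longrightarrow> extend_perm (\<lambda>x. x) S S g = g"
  by (rule Bij_ext[of _ S]) (simp_all add: extend_perm_Bij extend_perm_apply[of "\<lambda>x. x" S S])

lemma extend_perm_surj:
  assumes "bij_betw e S S'" "g' \<in> Bij S'"
  shows "\<exists>g\<in>Bij S. extend_perm e S S' g = g'"
proof
  let ?i = "inv_into S e"
  have e: "inj_on e S" "e ` S = S'" and i: "inj_on ?i S'" "?i ` S' = S"
    using assms(1) bij_betw_inv_into[OF assms(1)] by (auto simp: bij_betw_def)
  show k: "extend_perm ?i S' S g' \<in> Bij S"
    using i assms(2) by (simp add: extend_perm_Bij)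
  show "extend_perm e S S' (extend_perm ?i S' S g') = g'"
  proof (rule Bij_ext[OF _ assms(2)])
    show "extend_perm e S S' (extend_perm ?i S' S g') \<in> Bij S'"
      using e k by (simp add: extend_perm_Bij)
    fix y assume y: "y \<in> S'"
    then have ey: "e (?i y) = y" "?i y \<in> S" using e by (auto simp: f_inv_into_f inv_into_into)
    then have "extend_perm e S S' (extend_perm ?i S' S g') y = e (extend_perm ?i S' S g' (?i y))"
      using extend_perm_apply[of e S S' "?i y"] e by simp
    also have "\<dots> = e (?i (g' y))"
      using y i by (simp add: extend_perm_apply)
    also have "\<dots> = g' y"
      using e Bij_mem[OF assms(2) y] by (simp add: f_inv_into_f)
    finally show "extend_perm e S S' (extend_perm ?i S' S g') y = g' y" .
  qed
qed

section \<open>Automorphism groups and actions along tree isomorphisms\<close>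

lemma carrier_aut_group:
  "(p, q) \<in> carrier (aut_group T) \<longleftrightarrow> p \<in> Bij (verts T) \<and> q \<in> Bij (arcs T) \<and> graph_hom T T p q"
  by (simp add: aut_group_def)

lemma mult_aut_group:
  "\<lbrakk>p \<in> Bij (verts T); q \<in> Bij (arcs T); p' \<in> Bij (verts T); q' \<in> Bij (arcs T)\<rbrakk> \<Longrightarrow>
     (p, q) \<otimes>\<^bsub>aut_group T\<^esub> (p', q') = (compose (verts T) p p', compose (arcs T) q q')"
  by (simp add: aut_group_def mult_BijGroup)

definition map_aut :: "('a \<Rightarrow> 'c) \<Rightarrow> ('b \<Rightarrow> 'd) \<Rightarrow> ('a, 'b) rgraph \<Rightarrow> ('c, 'd) rgraph \<Rightarrow>
    ('a \<Rightarrow> 'a) \<times> ('b \<Rightarrow> 'b) \<Rightarrow> ('c \<Rightarrow> 'c) \<times> ('d \<Rightarrow> 'd)" where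
  "map_aut f h T T' = (\<lambda>(p, q). (extend_perm f (verts T) (verts T') p, extend_perm h (arcs T) (arcs T') q))"

lemma map_aut_apply:
  assumes "graph_iso T T' f h"
  shows "v \<in> verts T \<Longrightarrow> fst (map_aut f h T T' g) (f v) = f (fst g v)"
    "a \<in> arcs T \<Longrightarrow> snd (map_aut f h T T' g) (h a) = h (snd g a)"
  using graph_isoD[OF assms]
  by (auto simp: map_aut_def extend_perm_apply split: prod.split)

text \<open>Both implications are used: one places the conjugate of an automorphism in the target
  group, the other makes conjugation surjective. As \<open>f\<close> and \<open>h\<close> are onto,
  quantifiers over \<open>T'\<close> become quantifiers over \<open>T\<close>, and injectivity
  cancels the two maps.\<close>

lemma graph_hom_extend_perm:
  assumes "is_graph T" "graph_iso T T' f h" "p \<in> Bij (verts T)" "q \<in> Bij (arcs T)"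
  shows "graph_hom T' T' (extend_perm f (verts T) (verts T') p) (extend_perm h (arcs T) (arcs T') q)
    \<longleftrightarrow> graph_hom T T p q"
proof -
  note i = graph_isoD[OF assms(2)]
  note a = map_aut_apply[OF assms(2), of _ "(p, q)", unfolded map_aut_def, simplified]
  define P where "P = extend_perm f (verts T) (verts T') p"
  define Q where "Q = extend_perm h (arcs T) (arcs T') q"
  have P: "P (f v) = f (p v)" "p v \<in> verts T" if "v \<in> verts T" for v
    using a(1) that Bij_mem[OF assms(3)] by (simp_all add: P_def)
  have Q: "Q (h v) = h (q v)" "q v \<in> arcs T" if "v \<in> arcs T" for v
    using a(2) that Bij_mem[OF assms(4)] by (simp_all add: Q_def)
  have f: "f u = f v \<longleftrightarrow> u = v" if "u \<in> verts T" "v \<in> verts T" for u v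
    using that i(4) by (simp add: inj_on_eq_iff)
  have h: "h u = h v \<longleftrightarrow> u = v" if "u \<in> arcs T" "v \<in> arcs T" for u v
    using that i(5) by (simp add: inj_on_eq_iff)
  have "graph_hom T' T' P Q \<longleftrightarrow> graph_hom T T p q"
    unfolding graph_hom_def Pi_iff i(6,7)[symmetric] ball_simps
    by (simp add: P Q f h graph_homD[OF i(1)] is_graphD[OF assms(1)])
  then show ?thesis by (simp add: P_def Q_def)
qed

lemma map_aut_carrier:
  assumes "is_graph T" "graph_iso T T' f h" "g \<in> carrier (aut_group T)"
  shows "map_aut f h T T' g \<in> carrier (aut_group T')"
  using assms graph_isoD[OF assms(2)] graph_hom_extend_perm[OF assms(1,2)]
  by (cases g) (simp add: carrier_aut_group map_aut_def extend_perm_Bij)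

lemma map_aut_surj:
  assumes "is_graph T" "graph_iso T T' f h" "g' \<in> carrier (aut_group T')"
  shows "\<exists>g\<in>carrier (aut_group T). map_aut f h T T' g = g'"
proof (cases g')
  case (Pair p' q')
  note i = graph_isoD[OF assms(2)]
  have c: "p' \<in> Bij (verts T')" "q' \<in> Bij (arcs T')" "graph_hom T' T' p' q'"
    using assms(3) Pair by (simp_all add: carrier_aut_group)
  obtain p q where p: "p \<in> Bij (verts T)" "extend_perm f (verts T) (verts T') p = p'"
    and q: "q \<in> Bij (arcs T)" "extend_perm h (arcs T) (arcs T') q = q'"
    using extend_perm_surj[OF i(2) c(1)] extend_perm_surj[OF i(3) c(2)] by blast
  then have "(p, q) \<in> carrier (aut_group T)"
    using c(3) graph_hom_extend_perm[OF assms(1,2) p(1) q(1)] by (simp add: carrier_aut_group)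
  then show ?thesis
    using p q Pair by (intro bexI[of _ "(p, q)"]) (simp_all add: map_aut_def)
qed

text \<open>Replaces the tree by an isomorphic copy. The inclusion in \<open>aut_group\<close> makes
  the elements of \<open>P\<close> pairs of extensional permutations, on which conjugation is
  injective and multiplicative.\<close>

lemma isomorphic_to_aut_action_transfer:
  assumes act: "isomorphic_to_aut_action G T \<alpha> P T'"
    and i: "graph_iso T' T'' f h"
    and P: "P \<subseteq> carrier (aut_group T')"
  shows "isomorphic_to_aut_action G T \<alpha> (map_aut f h T' T'' ` P) T''"
proof -
  obtain \<phi> f0 h0 where \<phi>: "\<phi> \<in> iso G ((aut_group T')\<lparr>carrier := P\<rparr>)" and i0: "graph_iso T T' f0 h0"
    and eq: "\<And>g v. \<lbrakk>g \<in> carrier G; v \<in> verts T\<rbrakk> \<Longrightarrow> fst (\<phi> g) (f0 v) = f0 (fst (\<alpha> g) v)"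
      "\<And>g a. \<lbrakk>g \<in> carrier G; a \<in> arcs T\<rbrakk> \<Longrightarrow> snd (\<phi> g) (h0 a) = h0 (snd (\<alpha> g) a)"
    using act by (auto simp: isomorphic_to_aut_action_def isomorphic_tree_actions_def)
  let ?c = "map_aut f h T' T''"
  note ii = graph_isoD[OF i]
  have bij: "p \<in> Bij (verts T')" "q \<in> Bij (arcs T')" if "(p, q) \<in> P" for p q
    using subsetD[OF P that] by (simp_all add: carrier_aut_group)
  have "?c \<in> iso ((aut_group T')\<lparr>carrier := P\<rparr>) ((aut_group T'')\<lparr>carrier := ?c ` P\<rparr>)"
  proof (rule isoI)
    show "?c \<in> hom ((aut_group T')\<lparr>carrier := P\<rparr>) ((aut_group T'')\<lparr>carrier := ?c ` P\<rparr>)"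
      using ii by (auto intro!: homI simp: map_aut_def mult_aut_group bij extend_perm_Bij extend_perm_compose)
    have "inj_on ?c P"
    proof (rule inj_onI)
      fix x y assume x: "x \<in> P" and y: "y \<in> P" and e: "?c x = ?c y"
      obtain p q p' q' where [simp]: "x = (p, q)" "y = (p', q')"
        by (cases x, cases y)
      have "p = p'"
        using inj_onD[OF inj_on_extend_perm[OF ii(4), of "verts T''"], of p p'] ii e bij x y
        by (simp add: map_aut_def)
      moreover have "q = q'"
        using inj_onD[OF inj_on_extend_perm[OF ii(5), of "arcs T''"], of q q'] ii e bij x y
        by (simp add: map_aut_def)
      ultimately show "x = y" by simp
    qed
    then show "bij_betw ?c (carrier ((aut_group T')\<lparr>carrier := P\<rparr>)) (carrier ((aut_group T'')\<lparr>carrier := ?c ` P\<rparr>))"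
      by (simp add: bij_betw_def)
  qed
  then have "?c \<circ> \<phi> \<in> iso G ((aut_group T'')\<lparr>carrier := ?c ` P\<rparr>)"
    using \<phi> iso_set_trans by blast
  moreover have "graph_iso T T'' (f \<circ> f0) (h \<circ> h0)"
    using i0 i by (rule graph_iso_trans)
  ultimately show ?thesis
    unfolding isomorphic_to_aut_action_def isomorphic_tree_actions_def
    using graph_homD[OF graph_isoD(1)[OF i0]]
    by (intro bexI[of _ "?c \<circ> \<phi>"] exI[of _ "f \<circ> f0"] exI[of _ "h \<circ> h0"])
      (auto simp: map_aut_apply[OF i] eq)
qed

section \<open>Universal groups of local action diagrams\<close>

lemma is_associated_treeD:
  assumes "is_associated_tree D A"
  shows "is_tree (ltree A)" "is_graph (ltree A)"
    "graph_hom (ltree A) (lbase D) (lproj_v A) (lproj_a A)"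
    "lproj_v A ` verts (ltree A) = verts (lbase D)"
    "lproj_a A ` arcs (ltree A) = arcs (lbase D)"
    "\<And>v a. \<lbrakk>v \<in> verts (ltree A); a \<in> arcs (lbase D); head (lbase D) a = lproj_v A v\<rbrakk> \<Longrightarrow>
       bij_betw (llab A) {b \<in> star (ltree A) v. lproj_a A b = a} ({a} \<times> lcol D a)"
  using assms by (auto simp: is_associated_tree_def is_treeD(2))

lemma is_ladD:
  assumes "is_lad D"
  shows "is_connected_graph (lbase D)" "is_graph (lbase D)"
    "v \<in> verts (lbase D) \<Longrightarrow> subgroup (lgrp D v) (BijGroup (lad_colours D v))"
    "\<lbrakk>v \<in> verts (lbase D); a \<in> star (lbase D) v\<rbrakk> \<Longrightarrow> {a} \<times> lcol D a \<in>
       orbits ((BijGroup (lad_colours D v))\<lparr>carrier := lgrp D v\<rparr>) (lad_colours D v) (\<lambda>g. g)"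
  using assms by (auto simp: is_lad_def is_connected_graph_def)

text \<open>The fibre bijection at the terminus of \<open>b\<close> takes its values in a product
  with a singleton, which is why the first component of a label records the base arc below
  \<open>b\<close>.\<close>

lemma llab_mem:
  assumes "is_associated_tree D A" "b \<in> arcs (ltree A)"
  shows "fst (llab A b) = lproj_a A b" "snd (llab A b) \<in> lcol D (lproj_a A b)"
    "llab A b \<in> lad_colours D (lproj_v A (head (ltree A) b))"
proof -
  note A = is_associated_treeD[OF assms(1)]
  note k = graph_homD[OF A(3)]
  have "llab A ` {c \<in> star (ltree A) (head (ltree A) b). lproj_a A c = lproj_a A b} =
      {lproj_a A b} \<times> lcol D (lproj_a A b)"
    using A(6)[of "head (ltree A) b" "lproj_a A b"] assms(2)
    by (simp add: bij_betw_def is_graphD[OF A(2)] k)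
  then have "llab A b \<in> {lproj_a A b} \<times> lcol D (lproj_a A b)"
    using assms(2) by (auto simp: star_def)
  then show "fst (llab A b) = lproj_a A b" "snd (llab A b) \<in> lcol D (lproj_a A b)"
    "llab A b \<in> lad_colours D (lproj_v A (head (ltree A) b))"
    using assms(2) by (auto simp: lad_colours_def star_def k)
qed

text \<open>The fibres over the base arcs ending at \<open>lproj_v A v\<close> partition the star,
  and labels from different fibres cannot clash, since their first components differ.\<close>

lemma bij_betw_llab:
  assumes "is_associated_tree D A" "v \<in> verts (ltree A)"
  shows "bij_betw (llab A) (star (ltree A) v) (lad_colours D (lproj_v A v))"
proof -
  note A = is_associated_treeD[OF assms(1)]
  note k = graph_homD[OF A(3)]
  note l = llab_mem[OF assms(1)]
  have inj: "inj_on (llab A) (star (ltree A) v)"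
  proof (rule inj_onI)
    fix b c assume b: "b \<in> star (ltree A) v" and c: "c \<in> star (ltree A) v" and eq: "llab A b = llab A c"
    have "lproj_a A b = lproj_a A c"
      using b c eq l(1)[of b] l(1)[of c] by (simp add: star_def)
    then show "b = c"
      using A(6)[OF assms(2), of "lproj_a A b"] b c eq
      by (auto simp: star_def k bij_betw_def dest: inj_onD)
  qed
  have "lad_colours D (lproj_v A v) \<subseteq> llab A ` star (ltree A) v"
  proof
    fix x assume "x \<in> lad_colours D (lproj_v A v)"
    then obtain a where "a \<in> arcs (lbase D)" "head (lbase D) a = lproj_v A v" "x \<in> {a} \<times> lcol D a"
      by (auto simp: lad_colours_def star_def)
    then show "x \<in> llab A ` star (ltree A) v"
      using bij_betw_imp_surj_on[OF A(6)[OF assms(2), of a]] by blast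
  qed
  moreover have "llab A ` star (ltree A) v \<subseteq> lad_colours D (lproj_v A v)"
    using l(3) by (auto simp: star_def)
  ultimately show ?thesis
    using inj by (auto simp: bij_betw_def)
qed

text \<open>Frees the acceptability condition from \<open>inv_into\<close>. The labels exhaust the
  colours at \<open>v\<close>, so an element of the local group that agrees with \<open>q\<close> on
  the labels of the star must be the local action itself.\<close>

lemma lad_local_action_mem_iff:
  assumes "is_associated_tree D A" "v \<in> verts (ltree A)"
    "subgroup (lgrp D (lproj_v A v)) (BijGroup (lad_colours D (lproj_v A v)))"
  shows "lad_local_action D A q v \<in> lgrp D (lproj_v A v) \<longleftrightarrow>
    (\<exists>\<sigma>\<in>lgrp D (lproj_v A v). \<forall>b\<in>star (ltree A) v. llab A (q b) = \<sigma> (llab A b))"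
    (is "?l \<longleftrightarrow> ?r")
proof -
  let ?X = "lad_colours D (lproj_v A v)" and ?S = "star (ltree A) v"
  have bij: "inj_on (llab A) ?S" "llab A ` ?S = ?X"
    using bij_betw_llab[OF assms(1,2)] by (auto simp: bij_betw_def)
  have loc: "lad_local_action D A q v (llab A b) = llab A (q b)" if "b \<in> ?S" for b
    using that bij by (auto simp: lad_local_action_def)
  show ?thesis
  proof
    assume ?l
    then show ?r
      using loc by (metis (no_types))
  next
    assume ?r
    then obtain \<sigma> where \<sigma>: "\<sigma> \<in> lgrp D (lproj_v A v)" "\<forall>b\<in>?S. llab A (q b) = \<sigma> (llab A b)" by blast
    have "lad_local_action D A q v \<in> extensional ?X"
      by (simp add: lad_local_action_def)
    moreover have "\<sigma> \<in> extensional ?X"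
      using subgroup_BijGroup_mem[OF assms(3) \<sigma>(1)] by (simp add: Bij_iff)
    moreover have "lad_local_action D A q v x = \<sigma> x" if "x \<in> ?X" for x
      using that loc \<sigma>(2) unfolding bij(2)[symmetric] by auto
    ultimately have "lad_local_action D A q v = \<sigma>"
      by (rule extensionalityI)
    with \<sigma>(1) show ?l by simp
  qed
qed

lemma lad_universal_group_subset: "lad_universal_group D A \<subseteq> carrier (aut_group (ltree A))"
  by (auto simp: lad_universal_group_def)

lemma mem_lad_universal_group_iff:
  assumes "is_lad D" "is_associated_tree D A"
  shows "(p, q) \<in> lad_universal_group D A \<longleftrightarrow> (p, q) \<in> carrier (aut_group (ltree A)) \<and>
     (\<forall>v\<in>verts (ltree A). lproj_v A (p v) = lproj_v A v) \<and>
     (\<forall>b\<in>arcs (ltree A). lproj_a A (q b) = lproj_a A b) \<and>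
     (\<forall>v\<in>verts (ltree A). \<exists>\<sigma>\<in>lgrp D (lproj_v A v).
        \<forall>b\<in>star (ltree A) v. llab A (q b) = \<sigma> (llab A b))"
proof -
  have "lad_local_action D A q v \<in> lgrp D (lproj_v A v) \<longleftrightarrow>
      (\<exists>\<sigma>\<in>lgrp D (lproj_v A v). \<forall>b\<in>star (ltree A) v. llab A (q b) = \<sigma> (llab A b))"
    if "v \<in> verts (ltree A)" for v
    using lad_local_action_mem_iff[OF assms(2) that] is_ladD(3)[OF assms(1)] that
      is_associated_treeD(4)[OF assms(2)] by blast
  then show ?thesis
    by (simp add: lad_universal_group_def)
qed

text \<open>Conjugation preserves and reflects each condition that defines the universal group, and
  every automorphism of the target tree is a conjugate. It serves both the renaming of a diagram and
  the comparison with the diagram of a constructed graph of group actions.\<close>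

lemma lad_universal_group_transfer:
  assumes D: "is_lad D" and A: "is_associated_tree D A"
    and D': "is_lad D'" and A': "is_associated_tree D' A'"
    and i: "graph_iso (ltree A) (ltree A') f h"
    and iv: "inj_on iv (verts (lbase D))"
    and pv: "\<And>v. v \<in> verts (ltree A) \<Longrightarrow> lproj_v A' (f v) = iv (lproj_v A v)"
    and ia: "inj_on ia (arcs (lbase D))"
    and pa: "\<And>b. b \<in> arcs (ltree A) \<Longrightarrow> lproj_a A' (h b) = ia (lproj_a A b)"
    and e: "\<And>v. v \<in> verts (lbase D) \<Longrightarrow> inj_on e (lad_colours D v)"
      "\<And>v. v \<in> verts (lbase D) \<Longrightarrow> e ` lad_colours D v \<subseteq> lad_colours D' (iv v)"
    and grp: "\<And>v. v \<in> verts (lbase D) \<Longrightarrow>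
      lgrp D' (iv v) = extend_perm e (lad_colours D v) (lad_colours D' (iv v)) ` lgrp D v"
    and lab: "\<And>b. b \<in> arcs (ltree A) \<Longrightarrow> llab A' (h b) = e (llab A b)"
  shows "lad_universal_group D' A' = map_aut f h (ltree A) (ltree A') ` lad_universal_group D A"
proof -
  let ?T = "ltree A" and ?T' = "ltree A'"
  let ?c = "map_aut f h ?T ?T'"
  note AD = is_associated_treeD[OF A]
  note k = graph_homD[OF AD(3)]
  note ii = graph_isoD[OF i]
  have key: "?c g \<in> lad_universal_group D' A' \<longleftrightarrow> g \<in> lad_universal_group D A"
    if g: "g \<in> carrier (aut_group ?T)" for g
  proof -
    obtain p q where gpq: "g = (p, q)" by (cases g)
    obtain P Q where PQ: "?c g = (P, Q)" by (cases "?c g")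
    have bij: "p \<in> Bij (verts ?T)" "q \<in> Bij (arcs ?T)" and hom: "graph_hom ?T ?T p q"
      using g gpq by (simp_all add: carrier_aut_group)
    have P: "P (f v) = f (p v)" "p v \<in> verts ?T" if "v \<in> verts ?T" for v
      using map_aut_apply(1)[OF i that, of g] that Bij_mem[OF bij(1)] by (simp_all add: gpq PQ[unfolded gpq])
    have Q: "Q (h b) = h (q b)" "q b \<in> arcs ?T" if "b \<in> arcs ?T" for b
      using map_aut_apply(2)[OF i that, of g] that Bij_mem[OF bij(2)] by (simp_all add: gpq PQ[unfolded gpq])
    have c: "(P, Q) \<in> carrier (aut_group ?T')"
      using map_aut_carrier[OF AD(2) i g] PQ by simp
    have 1: "(\<forall>v\<in>verts ?T'. lproj_v A' (P v) = lproj_v A' v) \<longleftrightarrow>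
        (\<forall>v\<in>verts ?T. lproj_v A (p v) = lproj_v A v)"
      unfolding ii(6)[symmetric] using iv by (simp add: P pv inj_on_eq_iff k)
    have 2: "(\<forall>v\<in>arcs ?T'. lproj_a A' (Q v) = lproj_a A' v) \<longleftrightarrow>
        (\<forall>v\<in>arcs ?T. lproj_a A (q v) = lproj_a A v)"
      unfolding ii(7)[symmetric] using ia by (simp add: Q pa inj_on_eq_iff k)
    \<comment> \<open>Compared only when \<open>p\<close> preserves the projection: then
      \<open>q b\<close>, whose terminus is \<open>p v\<close>, has its label among the colours at
      \<open>lproj_v A v\<close>, where \<open>e\<close> is injective.\<close>
    have 3: "(\<exists>\<sigma>\<in>lgrp D' (lproj_v A' (f v)). \<forall>b\<in>star ?T' (f v). llab A' (Q b) = \<sigma> (llab A' b)) \<longleftrightarrow>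
        (\<exists>\<sigma>\<in>lgrp D (lproj_v A v). \<forall>b\<in>star ?T v. llab A (q b) = \<sigma> (llab A b))"
      if pres: "\<forall>v\<in>verts ?T. lproj_v A (p v) = lproj_v A v" and v: "v \<in> verts ?T" for v
    proof -
      let ?w = "lproj_v A v"
      have w: "?w \<in> verts (lbase D)" using v k by blast
      let ?X = "lad_colours D ?w"
      have lb: "llab A b \<in> ?X" "llab A (q b) \<in> ?X" "b \<in> arcs ?T" if "b \<in> star ?T v" for b
        using that llab_mem(3)[OF A, of b] llab_mem(3)[OF A, of "q b"] pres Q(2)
        by (auto simp: star_def graph_homD[OF hom] v)
      have "\<sigma> (llab A b) \<in> ?X" if "\<sigma> \<in> lgrp D ?w" "b \<in> star ?T v" for \<sigma> b
        using that lb(1) subgroup_BijGroup_mem[OF is_ladD(3)[OF D w]] Bij_mem by metis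
      then show ?thesis
        unfolding pv[OF v] grp[OF w] graph_iso_star[OF AD(2) i v]
        using lb inj_on_eq_iff[OF e(1)[OF w]]
        by (simp add: Q lab extend_perm_apply[OF e(1)[OF w] e(2)[OF w]])
    qed
    have "(\<forall>v\<in>verts ?T'. \<exists>\<sigma>\<in>lgrp D' (lproj_v A' v). \<forall>b\<in>star ?T' v. llab A' (Q b) = \<sigma> (llab A' b)) \<longleftrightarrow>
        (\<forall>v\<in>verts ?T. \<exists>\<sigma>\<in>lgrp D (lproj_v A v). \<forall>b\<in>star ?T v. llab A (q b) = \<sigma> (llab A b))"
      if "\<forall>v\<in>verts ?T. lproj_v A (p v) = lproj_v A v"
      unfolding ii(6)[symmetric] using 3[OF that] by simp
    then show ?thesis
      unfolding PQ unfolding gpq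
      using mem_lad_universal_group_iff[OF D' A', of P Q] mem_lad_universal_group_iff[OF D A, of p q]
        1 2 c g gpq by blast
  qed
  show ?thesis
  proof (intro equalityI subsetI)
    fix g' assume g': "g' \<in> lad_universal_group D' A'"
    then obtain g where "g \<in> carrier (aut_group ?T)" "?c g = g'"
      using map_aut_surj[OF AD(2) i] lad_universal_group_subset by blast
    then show "g' \<in> ?c ` lad_universal_group D A"
      using key g' by blast
  next
    fix g' assume "g' \<in> ?c ` lad_universal_group D A"
    then show "g' \<in> lad_universal_group D' A'"
      using key lad_universal_group_subset by blast
  qed
qed

section \<open>Renaming a local action diagram\<close>

text \<open>\<open>ex\<close> may depend on the base arc, so that overlapping colour sets can be
  renamed apart.\<close>

definition map_lad :: "('a \<Rightarrow> 'c) \<Rightarrow> ('b \<Rightarrow> 'd) \<Rightarrow> ('b \<Rightarrow> 'x \<Rightarrow> 'y) \<Rightarrow>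
    ('a, 'b, 'x) local_action_diagram \<Rightarrow> ('c, 'd, 'y) local_action_diagram" where
  "map_lad iv ia ex D =
     (let e = (\<lambda>(a, x). (ia a, ex a x)) in
      \<lparr>lbase = map_graph iv ia (lbase D),
       lcol = (\<lambda>a'. let a = inv_into (arcs (lbase D)) ia a' in ex a ` lcol D a),
       lgrp = (\<lambda>v'. let X = lad_colours D (inv_into (verts (lbase D)) iv v') in
         extend_perm e X (e ` X) ` lgrp D (inv_into (verts (lbase D)) iv v'))\<rparr>)"

definition map_labelled_tree ::
    "('c \<Rightarrow> 'c2) \<Rightarrow> ('d \<Rightarrow> 'd2) \<Rightarrow> ('a \<Rightarrow> 'a2) \<Rightarrow> ('b \<Rightarrow> 'b2) \<Rightarrow> ('b \<Rightarrow> 'x \<Rightarrow> 'x2) \<Rightarrow>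
     ('c2, 'd2) rgraph \<Rightarrow> ('c, 'd, 'a, 'b, 'x) labelled_tree \<Rightarrow> ('c2, 'd2, 'a2, 'b2, 'x2) labelled_tree" where
  "map_labelled_tree f h iv ia ex T' A =
     \<lparr>ltree = T',
      lproj_v = (\<lambda>v. iv (lproj_v A (inv_into (verts (ltree A)) f v))),
      lproj_a = (\<lambda>b. ia (lproj_a A (inv_into (arcs (ltree A)) h b))),
      llab = (\<lambda>b. case llab A (inv_into (arcs (ltree A)) h b) of (a, x) \<Rightarrow> (ia a, ex a x))\<rparr>"

text \<open>\<open>orbit\<close> looks only at the carrier, hence the two unrelated records
  \<open>M\<close> and \<open>M'\<close>.\<close>

lemma orbit_extend_perm:
  assumes "inj_on e X" "e ` X \<subseteq> X'" "x \<in> X"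
  shows "orbit (M\<lparr>carrier := extend_perm e X X' ` H\<rparr>) (\<lambda>g. g) (e x) =
    e ` orbit (M'\<lparr>carrier := H\<rparr>) (\<lambda>g. g) x"
  by (simp add: orbit_def Setcompr_eq_image image_image extend_perm_apply[OF assms])

lemma
  fixes D :: "('a, 'b, 'x) local_action_diagram" and ex :: "'b \<Rightarrow> 'x \<Rightarrow> 'y"
  assumes D: "is_lad D" and iv: "inj_on iv (verts (lbase D))" and ia: "inj_on ia (arcs (lbase D))"
    and ex: "\<And>a. a \<in> arcs (lbase D) \<Longrightarrow> inj_on (ex a) (lcol D a)"
  defines "e \<equiv> \<lambda>(a, x). (ia a, ex a x)"
  shows inj_on_map_lad_colours: "inj_on e (lad_colours D v)"
    and lcol_map_lad: "a \<in> arcs (lbase D) \<Longrightarrow> lcol (map_lad iv ia ex D) (ia a) = ex a ` lcol D a"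
    and lad_colours_map_lad: "v \<in> verts (lbase D) \<Longrightarrow>
      lad_colours (map_lad iv ia ex D) (iv v) = e ` lad_colours D v"
    and lgrp_map_lad: "v \<in> verts (lbase D) \<Longrightarrow> lgrp (map_lad iv ia ex D) (iv v) =
      extend_perm e (lad_colours D v) (e ` lad_colours D v) ` lgrp D v"
    and is_lad_map_lad: "is_lad (map_lad iv ia ex D)"
proof -
  let ?D = "map_lad iv ia ex D"
  have base: "lbase ?D = map_graph iv ia (lbase D)"
    by (simp add: map_lad_def Let_def)
  note i = graph_iso_map_graph[OF iv ia, folded base]
  note ii = graph_isoD[OF i]
  note star = graph_iso_star[OF is_ladD(2)[OF D] i]
  have inj: "inj_on e (lad_colours D v)" for v
  proof (rule inj_onI)
    fix s t assume "s \<in> lad_colours D v" "t \<in> lad_colours D v" "e s = e t"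
    moreover obtain a x b y where "s = (a, x)" "t = (b, y)" by (cases s, cases t)
    ultimately show "s = t"
      using inj_onD[OF ia, of a b] inj_onD[OF ex, of a x y] by (auto simp: lad_colours_def star_def e_def)
  qed
  then show "inj_on e (lad_colours D v)" .
  show col: "lcol ?D (ia a) = ex a ` lcol D a" if "a \<in> arcs (lbase D)" for a
    using that ia by (simp add: map_lad_def Let_def)
  have image: "{ia a} \<times> lcol ?D (ia a) = e ` ({a} \<times> lcol D a)" if "a \<in> arcs (lbase D)" for a
    by (auto simp: col[OF that] e_def image_iff)
  show cols: "lad_colours ?D (iv v) = e ` lad_colours D v" if "v \<in> verts (lbase D)" for v
  proof -
    have "lad_colours ?D (iv v) = (\<Union>a\<in>star (lbase D) v. {ia a} \<times> lcol ?D (ia a))"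
      by (auto simp: lad_colours_def star[OF that])
    also have "\<dots> = (\<Union>a\<in>star (lbase D) v. e ` ({a} \<times> lcol D a))"
      by (intro SUP_cong refl image) (simp add: star_def)
    also have "\<dots> = e ` lad_colours D v"
      unfolding image_UN[symmetric] by (rule arg_cong[where f = "(`) e"]) (auto simp: lad_colours_def)
    finally show ?thesis .
  qed
  show grp: "lgrp ?D (iv v) = extend_perm e (lad_colours D v) (e ` lad_colours D v) ` lgrp D v"
    if "v \<in> verts (lbase D)" for v
    using that iv by (simp add: map_lad_def Let_def e_def)
  have "is_connected_graph (lbase ?D)"
    by (rule graph_iso_is_connected_graph[OF is_ladD(1)[OF D] i])
  moreover have "subgroup (lgrp ?D (iv v)) (BijGroup (lad_colours ?D (iv v)))"
    if "v \<in> verts (lbase D)" for v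
    unfolding cols[OF that] grp[OF that]
    by (rule subgroup_hom_image[OF extend_perm_hom is_ladD(3)[OF D that]]) (simp_all add: inj)
  moreover have "{ia a} \<times> lcol ?D (ia a) \<in>
      orbits ((BijGroup (lad_colours ?D (iv v)))\<lparr>carrier := lgrp ?D (iv v)\<rparr>) (lad_colours ?D (iv v)) (\<lambda>g. g)"
    if v: "v \<in> verts (lbase D)" and a: "a \<in> star (lbase D) v" for v a
  proof -
    obtain x where x: "x \<in> lad_colours D v"
      "{a} \<times> lcol D a = orbit ((BijGroup (lad_colours D v))\<lparr>carrier := lgrp D v\<rparr>) (\<lambda>g. g) x"
      using is_ladD(4)[OF D v a] by (auto simp: orbits_def)
    have "{ia a} \<times> lcol ?D (ia a) = e ` ({a} \<times> lcol D a)"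
      using a by (intro image) (simp add: star_def)
    also have "\<dots> = orbit ((BijGroup (lad_colours ?D (iv v)))\<lparr>carrier := lgrp ?D (iv v)\<rparr>) (\<lambda>g. g) (e x)"
      unfolding cols[OF v] grp[OF v] x(2)
      by (rule orbit_extend_perm[symmetric]) (simp_all add: inj x)
    finally show ?thesis
      unfolding orbits_def cols[OF v] using x(1) by blast
  qed
  ultimately show "is_lad ?D"
    unfolding is_lad_def ii(6)[symmetric] by (simp add: star)
qed

lemma
  fixes D :: "('a, 'b, 'x) local_action_diagram" and ex :: "'b \<Rightarrow> 'x \<Rightarrow> 'y"
  assumes D: "is_lad D" and A: "is_associated_tree D A" and i: "graph_iso (ltree A) T' f h"
    and iv: "inj_on iv (verts (lbase D))" and ia: "inj_on ia (arcs (lbase D))"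
    and ex: "\<And>a. a \<in> arcs (lbase D) \<Longrightarrow> inj_on (ex a) (lcol D a)"
  shows is_associated_tree_map:
      "is_associated_tree (map_lad iv ia ex D) (map_labelled_tree f h iv ia ex T' A)" (is ?assoc)
    and lad_universal_group_map:
      "lad_universal_group (map_lad iv ia ex D) (map_labelled_tree f h iv ia ex T' A) =
       map_aut f h (ltree A) T' ` lad_universal_group D A" (is ?group)
proof -
  let ?D = "map_lad iv ia ex D" and ?A = "map_labelled_tree f h iv ia ex T' A"
  define e where "e = (\<lambda>(a, x). (ia a, ex a x))"
  note L = lcol_map_lad[OF D iv ia ex] lad_colours_map_lad[OF D iv ia ex, folded e_def]
    lgrp_map_lad[OF D iv ia ex, folded e_def] is_lad_map_lad[OF D iv ia ex]
  have inj: "inj_on e (lad_colours D v)" for v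
    unfolding e_def by (rule inj_on_map_lad_colours[OF D iv ia ex])
  have base: "lbase ?D = map_graph iv ia (lbase D)"
    by (simp add: map_lad_def Let_def)
  note j = graph_iso_map_graph[OF iv ia, folded base]
  note jj = graph_isoD[OF j] and ii = graph_isoD[OF i]
  note AD = is_associated_treeD[OF A]
  note k = graph_homD[OF AD(3)]
  note ik = graph_homD[OF ii(1)] and jk = graph_homD[OF jj(1)]
  have tree: "ltree ?A = T'" by (simp add: map_labelled_tree_def)
  have pv: "lproj_v ?A (f v) = iv (lproj_v A v)" if "v \<in> verts (ltree A)" for v
    using that ii by (simp add: map_labelled_tree_def)
  have pa: "lproj_a ?A (h b) = ia (lproj_a A b)" if "b \<in> arcs (ltree A)" for b
    using that ii by (simp add: map_labelled_tree_def)
  have lab: "llab ?A (h b) = e (llab A b)" if "b \<in> arcs (ltree A)" for b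
    using that ii by (simp add: map_labelled_tree_def e_def)
  have hom: "graph_hom T' (lbase ?D) (lproj_v ?A) (lproj_a ?A)"
    unfolding graph_hom_def Pi_iff ii(6,7)[symmetric] ball_simps
    by (simp add: pv pa k ik jk is_graphD[OF AD(2)])
  have "lproj_v ?A ` verts T' = verts (lbase ?D)"
  proof -
    have "lproj_v ?A ` verts T' = iv ` lproj_v A ` verts (ltree A)"
      unfolding ii(6)[symmetric] image_image by (simp add: pv cong: image_cong)
    then show ?thesis using AD(4) jj(6) by simp
  qed
  moreover have "lproj_a ?A ` arcs T' = arcs (lbase ?D)"
  proof -
    have "lproj_a ?A ` arcs T' = ia ` lproj_a A ` arcs (ltree A)"
      unfolding ii(7)[symmetric] image_image by (simp add: pa cong: image_cong)
    then show ?thesis using AD(5) jj(7) by simp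
  qed
  moreover have "bij_betw (llab ?A) {b \<in> star T' (f v). lproj_a ?A b = ia a} ({ia a} \<times> lcol ?D (ia a))"
    if v: "v \<in> verts (ltree A)" and a: "a \<in> arcs (lbase D)" and eq: "head (lbase ?D) (ia a) = lproj_v ?A (f v)" for v a
  proof -
    let ?B = "{b \<in> star (ltree A) v. lproj_a A b = a}"
    have ha: "head (lbase D) a = lproj_v A v"
      using eq iv is_graphD[OF is_ladD(2)[OF D] a] k v by (simp add: jk a pv[OF v] inj_on_eq_iff)
    have B: "bij_betw (llab A) ?B ({a} \<times> lcol D a)"
      by (rule AD(6)[OF v a ha])
    have "{a} \<times> lcol D a \<subseteq> lad_colours D (lproj_v A v)"
      using a ha by (auto simp: lad_colours_def star_def)
    then have "bij_betw e ({a} \<times> lcol D a) (e ` ({a} \<times> lcol D a))"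
      using inj inj_on_subset by (blast intro: inj_on_imp_bij_betw)
    with B have "bij_betw (e \<circ> llab A) ?B (e ` ({a} \<times> lcol D a))"
      by (rule bij_betw_trans)
    moreover have "e ` ({a} \<times> lcol D a) = {ia a} \<times> lcol ?D (ia a)"
      by (auto simp: L(1)[OF _ a] e_def image_iff ex a)
    ultimately have 1: "bij_betw (e \<circ> llab A) ?B ({ia a} \<times> lcol ?D (ia a))"
      by simp
    have 2: "{b \<in> star T' (f v). lproj_a ?A b = ia a} = h ` ?B"
      unfolding graph_iso_star[OF AD(2) i v] using ia a by (auto simp: star_def pa inj_on_eq_iff k)
    have "bij_betw h ?B (h ` ?B)"
      using inj_on_subset[OF ii(5)] by (intro inj_on_imp_bij_betw) (auto simp: star_def)
    \<comment> \<open>On \<open>?B\<close> this composite is \<open>e \<circ> llab A\<close>;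
      cancelling the bijection \<open>h\<close> leaves the new labelling on the new fibre.\<close>
    moreover have "bij_betw (llab ?A \<circ> h) ?B ({ia a} \<times> lcol ?D (ia a))"
      using 1 by (subst bij_betw_cong[of _ _ "e \<circ> llab A"]) (auto simp: star_def lab)
    ultimately show ?thesis
      unfolding 2 by (simp add: bij_betw_comp_iff)
  qed
  ultimately show assoc: ?assoc
    unfolding is_associated_tree_def tree
    using graph_iso_is_tree[OF AD(1) i] hom by (simp flip: jj(7) ii(6))
  show ?group
    using lad_universal_group_transfer[OF D A L(4) assoc _ iv pv ia pa inj _ _ lab, unfolded tree, OF _ i]
      L(2,3) ex by simp
qed

section \<open>The diagram of a free graph of group actions\<close>

text \<open>A scaffolding only comes with a graph morphism to its base, whereas the projection of an
  associated tree has to be surjective. \<open>W\<close> will be the image of the projection on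
  vertices.\<close>

lemma connected_graph_closed:
  assumes "is_connected_graph \<Gamma>" "u \<in> W" "u \<in> verts \<Gamma>"
    and closed: "\<And>a. \<lbrakk>a \<in> arcs \<Gamma>; tail \<Gamma> a \<in> W\<rbrakk> \<Longrightarrow> head \<Gamma> a \<in> W"
  shows "verts \<Gamma> \<subseteq> W"
proof
  fix v assume "v \<in> verts \<Gamma>"
  then have "(u, v) \<in> rtrancl_on (verts \<Gamma>) (arcs_ends (pre_digraph.truncate \<Gamma>))"
    using assms by (auto simp: is_connected_graph_def strongly_connected_def reachable_def)
  then show "v \<in> W"
    using assms(2)
    by (induction rule: rtrancl_on.induct) (auto simp: arcs_ends_conv intro: closed)
qed

text \<open>The index keeps the copies apart when the sets \<open>X i\<close> overlap or coincide.
  Points in none of them are forgotten, so different \<open>g\<close> can give the same map.\<close>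

definition disjoint_action :: "'b set \<Rightarrow> ('b \<Rightarrow> 'x set) \<Rightarrow> ('x \<Rightarrow> 'x) \<Rightarrow> 'b \<times> 'x \<Rightarrow> 'b \<times> 'x" where
  "disjoint_action I X g = (\<lambda>z\<in>Sigma I X. (fst z, g (snd z)))"

lemma subgroup_disjoint_action:
  assumes "subgroup H (BijGroup Y)"
    and X: "\<And>i. i \<in> I \<Longrightarrow> X i \<subseteq> Y" "\<And>i g. \<lbrakk>i \<in> I; g \<in> H\<rbrakk> \<Longrightarrow> g ` X i = X i"
  shows "subgroup (disjoint_action I X ` H) (BijGroup (Sigma I X))"
proof -
  have H: "g \<in> Bij Y" if "g \<in> H" for g
    using subgroup_BijGroup_mem[OF assms(1) that] .
  have XY: "x \<in> Y" if "i \<in> I" "x \<in> X i" for i x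
    using X(1) that by blast
  have XX: "g x \<in> X i" if "i \<in> I" "x \<in> X i" "g \<in> H" for i x g
    using X(2)[OF that(1,3)] that(2) by blast
  have bij: "disjoint_action I X g \<in> Bij (Sigma I X)" if g: "g \<in> H" for g
  proof -
    have "inj_on (disjoint_action I X g) (Sigma I X)"
    proof (rule inj_onI)
      fix s t assume "s \<in> Sigma I X" "t \<in> Sigma I X" "disjoint_action I X g s = disjoint_action I X g t"
      then have "fst s = fst t" "g (snd s) = g (snd t)" "snd s \<in> Y" "snd t \<in> Y"
        by (auto simp: disjoint_action_def intro: XY)
      then show "s = t"
        using H[OF g] by (auto simp: Bij_iff prod_eq_iff dest: inj_onD)
    qed
    moreover have "disjoint_action I X g ` Sigma I X = (\<Union>i\<in>I. {i} \<times> g ` X i)"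
      by (force simp: disjoint_action_def image_iff)
    then have "disjoint_action I X g ` Sigma I X = Sigma I X"
      using X(2)[OF _ g] by auto
    ultimately show ?thesis
      by (simp add: Bij_iff disjoint_action_def)
  qed
  \<comment> \<open>The homomorphism starts from \<open>H\<close> and not from the full symmetric
    group: other permutations of \<open>Y\<close> need not preserve the sets
    \<open>X i\<close>.\<close>
  have "disjoint_action I X \<in> hom ((BijGroup Y)\<lparr>carrier := H\<rparr>) (BijGroup (Sigma I X))"
  proof (rule homI)
    fix g k assume "g \<in> carrier ((BijGroup Y)\<lparr>carrier := H\<rparr>)" "k \<in> carrier ((BijGroup Y)\<lparr>carrier := H\<rparr>)"
    then have g: "g \<in> H" and k: "k \<in> H" by simp_all
    have "disjoint_action I X (compose Y g k) = compose (Sigma I X) (disjoint_action I X g) (disjoint_action I X k)"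
    proof (rule extensionalityI[of _ "Sigma I X"])
      fix z assume z: "z \<in> Sigma I X"
      then have "snd z \<in> Y" "k (snd z) \<in> X (fst z)" using k by (auto intro: XY XX)
      with z show "disjoint_action I X (compose Y g k) z =
          compose (Sigma I X) (disjoint_action I X g) (disjoint_action I X k) z"
        by (auto simp: disjoint_action_def compose_def)
    qed (simp_all add: disjoint_action_def compose_def)
    then show "disjoint_action I X (g \<otimes>\<^bsub>(BijGroup Y)\<lparr>carrier := H\<rparr>\<^esub> k) =
        disjoint_action I X g \<otimes>\<^bsub>BijGroup (Sigma I X)\<^esub> disjoint_action I X k"
      using g k by (simp add: mult_BijGroup H bij)
  qed (simp add: bij)
  then interpret group_hom "(BijGroup Y)\<lparr>carrier := H\<rparr>" "BijGroup (Sigma I X)" "disjoint_action I X"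
    using subgroup.subgroup_is_group[OF assms(1) group_BijGroup]
    by (simp add: group_hom_def group_hom_axioms_def group_BijGroup)
  show ?thesis
    using img_is_subgroup by simp
qed

section \<open>Adhesion sets as orbits of points\<close>

locale free_gga =
  fixes \<G> :: "('a, 'b, 'x, 'y) gga"
  assumes free: "is_free_gga \<G>"
begin

text \<open>Adhesion sets are singletons here, so their union is the orbit of
  \<open>point a\<close>; see \<open>colours_eq\<close>.\<close>

definition colours :: "'b \<Rightarrow> 'x set" where
  "colours a = \<Union> (adhesion_sets \<G> a)"

definition lad :: "('a, 'b, 'x) local_action_diagram" where
  "lad = \<lparr>lbase = gbase \<G>, lcol = colours,
     lgrp = (\<lambda>v. disjoint_action (star (gbase \<G>) v) colours ` gvgrp \<G> v)\<rparr>"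

lemma gga_facts:
  "is_connected_graph (gbase \<G>)" "is_graph (gbase \<G>)"
  "v \<in> verts (gbase \<G>) \<Longrightarrow> subgroup (gvgrp \<G> v) (BijGroup (gvset \<G> v))"
  "a \<in> arcs (gbase \<G>) \<Longrightarrow> gemb \<G> a \<in> gaset \<G> a \<rightarrow> gvset \<G> (head (gbase \<G>) a)"
  "\<lbrakk>a \<in> arcs (gbase \<G>); arev (gbase \<G>) a = a\<rbrakk> \<Longrightarrow> gtwist \<G> a \<in> Bij (gaset \<G> a)"
  "a \<in> arcs (gbase \<G>) \<Longrightarrow> \<exists>y. gaset \<G> a = {y}"
  using free
  by (auto simp: is_free_gga_def is_gga_def is_connected_graph_def perm_group_action_def
      action_embedding_def Let_def)

definition point :: "'b \<Rightarrow> 'x" where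
  "point a = gemb \<G> a (the_elem (gaset \<G> a))"

lemma point: "\<lbrakk>a \<in> arcs (gbase \<G>); y \<in> gaset \<G> a\<rbrakk> \<Longrightarrow> gemb \<G> a y = point a"
  using gga_facts(6)[of a] by (auto simp: point_def)

lemma point_mem: "a \<in> arcs (gbase \<G>) \<Longrightarrow> point a \<in> gvset \<G> (head (gbase \<G>) a)"
  using gga_facts(4,6)[of a] by (auto simp: point_def)

lemma adhesion_maps_eq:
  assumes "a \<in> arcs (gbase \<G>)"
  shows "adhesion_maps \<G> a = (\<lambda>g. \<lambda>y\<in>gaset \<G> a. g (point a)) ` gvgrp \<G> (head (gbase \<G>) a)"
  unfolding adhesion_maps_def Setcompr_eq_image
  by (intro image_cong refl restrict_ext) (simp add: point assms)

text \<open>\<open>gtwist\<close> permutes a one-element set and so disappears after composition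
  with the embedding. Self-reverse arcs can then be treated like all others.\<close>

lemma twisted_adhesion_maps_eq:
  assumes "a \<in> arcs (gbase \<G>)" "arev (gbase \<G>) a = a"
  shows "twisted_adhesion_maps \<G> a = adhesion_maps \<G> a"
  unfolding adhesion_maps_eq[OF assms(1)] twisted_adhesion_maps_def Setcompr_eq_image
  by (intro image_cong refl restrict_ext) (simp add: point assms Bij_mem gga_facts(5))

lemma colours_eq:
  assumes "a \<in> arcs (gbase \<G>)"
  shows "colours a = (\<lambda>g. g (point a)) ` gvgrp \<G> (head (gbase \<G>) a)"
  using gga_facts(6)[OF assms] by (auto simp: colours_def adhesion_sets_def adhesion_maps_eq[OF assms])

lemma adhesion_sets_eq:
  assumes "a \<in> arcs (gbase \<G>)"
  shows "adhesion_sets \<G> a = (\<lambda>x. {x}) ` colours a"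
  using gga_facts(6)[OF assms]
  by (auto simp: colours_eq[OF assms] adhesion_sets_def adhesion_maps_eq[OF assms] image_image)

lemma colours_subset:
  assumes "a \<in> star (gbase \<G>) v" "v \<in> verts (gbase \<G>)"
  shows "colours a \<subseteq> gvset \<G> v" "g \<in> gvgrp \<G> v \<Longrightarrow> g ` colours a = colours a"
proof -
  have a: "a \<in> arcs (gbase \<G>)" "head (gbase \<G>) a = v" using assms by (auto simp: star_def)
  note sub = gga_facts(3)[OF assms(2)]
  have bij: "g \<in> Bij (gvset \<G> v)" if "g \<in> gvgrp \<G> v" for g
    using subgroup_BijGroup_mem[OF sub that] .
  have pt: "point a \<in> gvset \<G> v" using point_mem a by auto
  then show "colours a \<subseteq> gvset \<G> v"
    using bij a by (auto simp: colours_eq Bij_mem)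
  have comp: "g (k (point a)) \<in> colours a" if "g \<in> gvgrp \<G> v" "k \<in> gvgrp \<G> v" for g k
  proof -
    have "compose (gvset \<G> v) g k \<in> gvgrp \<G> v"
      using subgroup.m_closed[OF sub that] bij that by (simp add: mult_BijGroup)
    then show ?thesis
      using pt a by (auto simp: colours_eq compose_def image_iff intro!: bexI[of _ "compose (gvset \<G> v) g k"])
  qed
  show "g ` colours a = colours a" if g: "g \<in> gvgrp \<G> v"
  proof
    show "g ` colours a \<subseteq> colours a"
      using comp[OF g] a by (auto simp: colours_eq)
    show "colours a \<subseteq> g ` colours a"
    proof
      fix x assume "x \<in> colours a"
      then obtain k where k: "k \<in> gvgrp \<G> v" "x = k (point a)" using a by (auto simp: colours_eq)
      \<comment> \<open>The inverse of \<open>g\<close> moves \<open>x\<close> within the orbit and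
        thus supplies a preimage of \<open>x\<close>.\<close>
      let ?i = "inv\<^bsub>BijGroup (gvset \<G> v)\<^esub> g"
      have i: "?i \<in> gvgrp \<G> v" by (rule subgroup.m_inv_closed[OF sub g])
      have "g \<otimes>\<^bsub>BijGroup (gvset \<G> v)\<^esub> ?i = \<one>\<^bsub>BijGroup (gvset \<G> v)\<^esub>"
        using bij[OF g] by (intro group.r_inv group_BijGroup) simp
      then have "compose (gvset \<G> v) g ?i = (\<lambda>x\<in>gvset \<G> v. x)"
        using bij[OF g] bij[OF i] by (simp add: mult_BijGroup one_BijGroup)
      moreover have x: "x \<in> gvset \<G> v" using k bij pt by (simp add: Bij_mem)
      ultimately have "g (?i x) = x"
        by (metis compose_eq restrict_apply')
      moreover have "?i x \<in> colours a" using comp[OF i k(1)] k(2) by simp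
      ultimately show "x \<in> g ` colours a" by (metis imageI)
    qed
  qed
qed

lemma lad_sel [simp]: "lbase lad = gbase \<G>" "lcol lad = colours"
  "lgrp lad v = disjoint_action (star (gbase \<G>) v) colours ` gvgrp \<G> v"
  by (simp_all add: lad_def)

lemma lad_colours_lad: "lad_colours lad v = Sigma (star (gbase \<G>) v) colours"
  by (simp add: lad_colours_def)

lemma is_lad_lad: "is_lad lad"
proof -
  have "subgroup (lgrp lad v) (BijGroup (lad_colours lad v))" if "v \<in> verts (gbase \<G>)" for v
    unfolding lad_colours_lad lad_sel
    by (rule subgroup_disjoint_action[OF gga_facts(3)[OF that]]) (use colours_subset that in blast)+
  moreover have "{a} \<times> colours a \<in> orbits ((BijGroup (lad_colours lad v))\<lparr>carrier := lgrp lad v\<rparr>)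
      (lad_colours lad v) (\<lambda>g. g)" if v: "v \<in> verts (gbase \<G>)" and a: "a \<in> star (gbase \<G>) v" for v a
  proof -
    have a': "a \<in> arcs (gbase \<G>)" "head (gbase \<G>) a = v" using a by (auto simp: star_def)
    \<comment> \<open>Writing the point as a value of the identity places it in its own
      orbit.\<close>
    have "point a = (\<lambda>x\<in>gvset \<G> v. x) (point a)" using point_mem a' by auto
    then have pt: "point a \<in> colours a"
      using subgroup.one_closed[OF gga_facts(3)[OF v]] a' unfolding colours_eq[OF a'(1)] one_BijGroup
      by (metis image_eqI)
    then have mem: "(a, point a) \<in> lad_colours lad v" using a by (simp add: lad_colours_lad)
    have "{a} \<times> colours a = (\<lambda>g. (a, g (point a))) ` gvgrp \<G> v"
      using a' by (auto simp: colours_eq)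
    also have "\<dots> = orbit ((BijGroup (lad_colours lad v))\<lparr>carrier := lgrp lad v\<rparr>) (\<lambda>g. g) (a, point a)"
      using pt a by (simp add: orbit_def Setcompr_eq_image image_image disjoint_action_def)
    finally show ?thesis using mem unfolding orbits_def by blast
  qed
  ultimately show ?thesis
    by (simp add: is_lad_def gga_facts)
qed

end

section \<open>Scaffoldings of a free graph of group actions as associated trees\<close>

locale free_scaffolding = free_gga \<G>
  for \<G> :: "('a, 'b, 'x, 'y) gga" +
  fixes S :: "('s, 'e, 'a, 'b, 'x, 'y) scaffolding"
  assumes scaffolding: "is_scaffolding \<G> S"
begin

abbreviation "\<Sigma> \<equiv> sgraph S"
abbreviation "R \<equiv> srel S"
abbreviation "T \<equiv> scaf_tree S"

lemma scaf_facts: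
  "is_graph \<Sigma>" "equiv (verts \<Sigma>) R" "is_tree T" "is_graph T"
  "graph_hom T (gbase \<G>) (sproj_v S) (sproj_a S)"
  "C \<in> verts T \<Longrightarrow> bij_betw (scol_v S) C (gvset \<G> (sproj_v S C))"
  "E \<in> arcs T \<Longrightarrow> bij_betw (scol_a S) E (gaset \<G> (sproj_a S E))"
  using scaffolding is_treeD(2) by (auto simp: is_scaffolding_def legal_colouring_def)

text \<open>At a self-reverse arc the legal colouring leaves open which of the two directions is
  twisted; since twisted maps are adhesion maps here, both cases agree.\<close>

lemma psi_adhesion_map:
  assumes "E \<in> arcs T"
  shows "scaf_psi \<G> S E \<in> adhesion_maps \<G> (sproj_a S E)"
proof -
  have "sproj_a S E \<in> arcs (gbase \<G>)" using graph_homD[OF scaf_facts(5)] assms by blast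
  then show ?thesis
    using scaffolding assms twisted_adhesion_maps_eq[of "sproj_a S E"]
    by (auto simp: is_scaffolding_def legal_colouring_def Let_def split: if_splits)
qed

lemma ex1_arc:
  "\<lbrakk>C \<in> verts T; b \<in> star (gbase \<G>) (sproj_v S C); Z \<in> adhesion_sets \<G> b\<rbrakk> \<Longrightarrow>
     \<exists>!E. E \<in> star T C \<and> sproj_a S E = b \<and> scaf_psi \<G> S E ` gaset \<G> b = Z"
  using scaffolding by (auto simp: is_scaffolding_def legal_colouring_def)

lemma verts_T: "verts T = verts \<Sigma> // R"
  by (simp add: scaf_tree_def quotient_graph_def)

lemma equiv_arc_rel: "equiv (arcs \<Sigma>) (arc_rel \<Sigma> R)"
proof -
  have *: "(u, u) \<in> R" if "u \<in> verts \<Sigma>" for u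
    using scaf_facts(2) that by (auto simp: equiv_def refl_on_def)
  have "arc_rel \<Sigma> R \<subseteq> arcs \<Sigma> \<times> arcs \<Sigma>" by (auto simp: arc_rel_def)
  moreover have "refl_on (arcs \<Sigma>) (arc_rel \<Sigma> R)"
    by (auto simp: refl_on_def arc_rel_def is_graphD[OF scaf_facts(1)] *)
  moreover have "sym (arc_rel \<Sigma> R)" "trans (arc_rel \<Sigma> R)"
    using scaf_facts(2) unfolding equiv_def arc_rel_def
    by (auto intro!: symI transI dest: symD intro: transD)
  ultimately show ?thesis by (auto simp: equiv_def)
qed

text \<open>The arc colouring maps a class of arcs bijectively to \<open>gaset\<close>, which has
  one element by freeness. Hence a permutation of the tree arcs lifts to the arcs of
  \<open>\<Sigma>\<close> in exactly one way.\<close>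

lemma arc_class: "b \<in> arcs \<Sigma> \<Longrightarrow> arc_rel \<Sigma> R `` {b} = {b}" "b \<in> arcs \<Sigma> \<Longrightarrow> {b} \<in> arcs T"
proof -
  assume b: "b \<in> arcs \<Sigma>"
  let ?E = "arc_rel \<Sigma> R `` {b}"
  have E: "?E \<in> arcs T" using b by (simp add: scaf_tree_def quotient_graph_def quotientI)
  have bE: "b \<in> ?E" using equiv_class_self[OF equiv_arc_rel b] .
  obtain y where "gaset \<G> (sproj_a S ?E) = {y}"
    using gga_facts(6) graph_homD(2)[OF scaf_facts(5) E] by blast
  then have inj: "inj_on (scol_a S) ?E" and im: "scol_a S ` ?E = {y}"
    using scaf_facts(7)[OF E] by (simp_all add: bij_betw_def)
  have "c = b" if "c \<in> ?E" for c
    using inj_onD[OF inj _ that bE] imageI[OF that, of "scol_a S"] imageI[OF bE, of "scol_a S"]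
    unfolding im by simp
  with bE show "?E = {b}" by blast
  with E show "{b} \<in> arcs T" by simp
qed

lemma arcs_T: "arcs T = (\<lambda>b. {b}) ` arcs \<Sigma>"
proof
  show "arcs T \<subseteq> (\<lambda>b. {b}) ` arcs \<Sigma>"
    using arc_class(1) by (auto simp: scaf_tree_def quotient_graph_def elim!: quotientE)
qed (auto simp: arc_class)

lemma T_sel: "tail T {b} = R `` {tail \<Sigma> b}" "head T {b} = R `` {head \<Sigma> b}" "arev T {b} = {arev \<Sigma> b}"
  by (simp_all add: scaf_tree_def quotient_graph_def)

lemma class_mem: "x \<in> verts \<Sigma> \<Longrightarrow> R `` {x} \<in> verts T" "x \<in> verts \<Sigma> \<Longrightarrow> x \<in> R `` {x}"
  using equiv_class_self[OF scaf_facts(2)] by (auto simp: verts_T quotientI)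

lemma class_eq: "\<lbrakk>C \<in> verts T; x \<in> C\<rbrakk> \<Longrightarrow> C = R `` {x}" "\<lbrakk>C \<in> verts T; x \<in> C\<rbrakk> \<Longrightarrow> x \<in> verts \<Sigma>"
  "C \<in> verts T \<Longrightarrow> \<exists>x. x \<in> C"
proof -
  show "C = R `` {x}" if "C \<in> verts T" "x \<in> C"
    using that equiv_class_eq[OF scaf_facts(2)] by (auto simp: verts_T elim!: quotientE)
  show "x \<in> verts \<Sigma>" if "C \<in> verts T" "x \<in> C"
    using that in_quotient_imp_subset[OF scaf_facts(2)] by (auto simp: verts_T)
  show "\<exists>x. x \<in> C" if "C \<in> verts T"
    using that in_quotient_imp_non_empty[OF scaf_facts(2)] by (auto simp: verts_T)
qed

lemma rel_iff: "\<lbrakk>x \<in> verts \<Sigma>; y \<in> verts \<Sigma>\<rbrakk> \<Longrightarrow> (x, y) \<in> R \<longleftrightarrow> R `` {x} = R `` {y}"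
  using eq_equiv_class_iff[OF scaf_facts(2)] by blast

lemma gaset_arc: "b \<in> arcs \<Sigma> \<Longrightarrow> gaset \<G> (sproj_a S {b}) = {scol_a S b}"
  using scaf_facts(7)[OF arc_class(2)] by (auto simp: bij_betw_def)

lemma psi_arc:
  assumes "b \<in> arcs \<Sigma>"
  shows "scaf_psi \<G> S {b} ` gaset \<G> (sproj_a S {b}) = {scol_v S (head \<Sigma> b)}"
  using inv_into_into[of "scol_a S b" "scol_a S" "{b}"]
  by (simp add: gaset_arc[OF assms] scaf_psi_def)

text \<open>The colour of an arc takes a single value on each class and distinguishes nothing, so
  the label uses the colour of the terminus: this is the one element of the adhesion set belonging
  to the arc.\<close>

definition labelled :: "('s set, 'e set, 'a, 'b, 'x) labelled_tree" where
  "labelled = \<lparr>ltree = T, lproj_v = sproj_v S, lproj_a = sproj_a S,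
     llab = (\<lambda>E. (sproj_a S E, scol_v S (head \<Sigma> (the_elem E))))\<rparr>"

lemma labelled_sel [simp]: "ltree labelled = T" "lproj_v labelled = sproj_v S" "lproj_a labelled = sproj_a S"
  "llab labelled {b} = (sproj_a S {b}, scol_v S (head \<Sigma> b))"
  by (simp_all add: labelled_def)

lemma head_mem: "b \<in> arcs \<Sigma> \<Longrightarrow> head \<Sigma> b \<in> head T {b}"
  using class_mem is_graphD[OF scaf_facts(1)] by (simp add: T_sel)

lemma colour_head:
  assumes "b \<in> arcs \<Sigma>"
  shows "scol_v S (head \<Sigma> b) \<in> colours (sproj_a S {b})"
proof -
  have a: "sproj_a S {b} \<in> arcs (gbase \<G>)" using graph_homD(2)[OF scaf_facts(5) arc_class(2)[OF assms]] .
  have "scaf_psi \<G> S {b} ` gaset \<G> (sproj_a S {b}) \<in> adhesion_sets \<G> (sproj_a S {b})"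
    using psi_adhesion_map[OF arc_class(2)[OF assms]] by (simp add: adhesion_sets_def)
  then show ?thesis
    unfolding psi_arc[OF assms] adhesion_sets_eq[OF a] by auto
qed

lemma is_associated_tree_labelled: "is_associated_tree lad labelled"
proof -
  note k = graph_homD[OF scaf_facts(5)]
  \<comment> \<open>The uniqueness axiom of a legal colouring, read for arcs of
    \<open>\<Sigma>\<close>: the adhesion set is \<open>{x}\<close>, and the arc realising it is the
    one whose terminus has colour \<open>x\<close>.\<close>
  have ex: "\<exists>!b. b \<in> arcs \<Sigma> \<and> {b} \<in> star T C \<and> sproj_a S {b} = a \<and> scol_v S (head \<Sigma> b) = x"
    if C: "C \<in> verts T" and a: "a \<in> star (gbase \<G>) (sproj_v S C)" and x: "x \<in> colours a" for C a x
  proof -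
    have "a \<in> arcs (gbase \<G>)" using a by (simp add: star_def)
    then have "{x} \<in> adhesion_sets \<G> a" using x by (simp add: adhesion_sets_eq)
    note ex1 = ex1_arc[OF C a this]
    have eq: "{b} \<in> star T C \<and> sproj_a S {b} = a \<and> scaf_psi \<G> S {b} ` gaset \<G> a = {x} \<longleftrightarrow>
        {b} \<in> star T C \<and> sproj_a S {b} = a \<and> scol_v S (head \<Sigma> b) = x" if "b \<in> arcs \<Sigma>" for b
      using psi_arc[OF that] by auto
    have "\<And>E. E \<in> star T C \<Longrightarrow> \<exists>b\<in>arcs \<Sigma>. E = {b}" by (auto simp: star_def arcs_T)
    then show ?thesis
      using ex1 eq by (metis (no_types, lifting) singleton_inject)
  qed
  have bij: "bij_betw (llab labelled) {E \<in> star T C. sproj_a S E = a} ({a} \<times> colours a)"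
    if C: "C \<in> verts T" and a: "a \<in> arcs (gbase \<G>)" "head (gbase \<G>) a = sproj_v S C" for C a
  proof -
    have st: "a \<in> star (gbase \<G>) (sproj_v S C)" using a by (simp add: star_def)
    have sing: "\<exists>b\<in>arcs \<Sigma>. E = {b}" if "E \<in> star T C" for E
      using that by (auto simp: star_def arcs_T)
    show ?thesis
    proof (rule bij_betw_imageI)
      show "inj_on (llab labelled) {E \<in> star T C. sproj_a S E = a}"
      proof (rule inj_onI)
        fix E E' assume E: "E \<in> {E \<in> star T C. sproj_a S E = a}" "E' \<in> {E \<in> star T C. sproj_a S E = a}"
          and eq: "llab labelled E = llab labelled E'"
        then obtain b b' where b: "b \<in> arcs \<Sigma>" "E = {b}" "b' \<in> arcs \<Sigma>" "E' = {b'}"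
          using sing by (metis (no_types, lifting) mem_Collect_eq)
        then have "scol_v S (head \<Sigma> b) \<in> colours a" using E colour_head by auto
        from ex[OF C st this] show "E = E'"
          using b E eq by auto
      qed
      show "llab labelled ` {E \<in> star T C. sproj_a S E = a} = {a} \<times> colours a"
      proof (intro equalityI subsetI)
        fix z assume "z \<in> llab labelled ` {E \<in> star T C. sproj_a S E = a}"
        then show "z \<in> {a} \<times> colours a"
          using sing colour_head by fastforce
      next
        fix z assume "z \<in> {a} \<times> colours a"
        then obtain x where "z = (a, x)" "x \<in> colours a" by auto
        moreover from ex[OF C st this(2)] obtain b where
          "{b} \<in> star T C" "sproj_a S {b} = a" "scol_v S (head \<Sigma> b) = x" by blast
        ultimately show "z \<in> llab labelled ` {E \<in> star T C. sproj_a S E = a}"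
          by (auto intro!: image_eqI[of _ _ "{b}"])
      qed
    qed
  qed
  \<comment> \<open>A colour set is an orbit and so non-empty; the fibre bijection then makes the
    fibre non-empty too.\<close>
  have lift: "\<exists>E\<in>star T C. sproj_a S E = a"
    if C: "C \<in> verts T" and a: "a \<in> arcs (gbase \<G>)" "head (gbase \<G>) a = sproj_v S C" for C a
  proof -
    have "{a} \<times> colours a \<noteq> {}"
    proof -
      have v: "head (gbase \<G>) a \<in> verts (gbase \<G>)" using is_graphD[OF gga_facts(2)] a by blast
      show ?thesis
        using a subgroup.one_closed[OF gga_facts(3)[OF v]] by (auto simp: colours_eq)
    qed
    then show ?thesis using bij_betw_imp_surj_on[OF bij[OF C a]] by auto
  qed
  have verts: "sproj_v S ` verts T = verts (gbase \<G>)"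
  proof
    show "sproj_v S ` verts T \<subseteq> verts (gbase \<G>)" using k by auto
    obtain C where C: "C \<in> verts T" using is_treeD(3)[OF scaf_facts(3)] by auto
    show "verts (gbase \<G>) \<subseteq> sproj_v S ` verts T"
    proof (rule connected_graph_closed[OF gga_facts(1), of "sproj_v S C"])
      fix a assume a: "a \<in> arcs (gbase \<G>)" and "tail (gbase \<G>) a \<in> sproj_v S ` verts T"
      then obtain B where B: "B \<in> verts T" "tail (gbase \<G>) a = sproj_v S B" by auto
      \<comment> \<open>Lifts exist at termini, whereas \<open>a\<close> starts below
        \<open>B\<close>. So the reverse of \<open>a\<close> is lifted, and the origin of the lift
        lies over \<open>head (gbase \<G>) a\<close>.\<close>
      then obtain E where "E \<in> arcs T" "sproj_a S E = arev (gbase \<G>) a"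
        using lift[OF B(1), of "arev (gbase \<G>) a"] is_graphD[OF gga_facts(2) a] by (auto simp: star_def)
      then have "head (gbase \<G>) a = sproj_v S (tail T E)" "tail T E \<in> verts T"
        using k is_graphD[OF gga_facts(2) a] is_graphD[OF scaf_facts(4)] by metis+
      then show "head (gbase \<G>) a \<in> sproj_v S ` verts T" by auto
    qed (use C k in auto)
  qed
  have "sproj_a S ` arcs T = arcs (gbase \<G>)"
  proof
    show "sproj_a S ` arcs T \<subseteq> arcs (gbase \<G>)" using k by auto
    show "arcs (gbase \<G>) \<subseteq> sproj_a S ` arcs T"
    proof
      fix a assume a: "a \<in> arcs (gbase \<G>)"
      then have "head (gbase \<G>) a \<in> sproj_v S ` verts T" using is_graphD[OF gga_facts(2) a] verts by simp
      then show "a \<in> sproj_a S ` arcs T" using lift a by (fastforce simp: star_def)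
    qed
  qed
  then show ?thesis
    using verts bij by (simp add: is_associated_tree_def scaf_facts)
qed

section \<open>Comparison of the two universal groups\<close>

lemma gga_local_action_mem_iff:
  assumes "C \<in> verts T"
  shows "gga_local_action \<G> S f C \<in> gvgrp \<G> (sproj_v S C) \<longleftrightarrow>
    (\<exists>\<sigma>\<in>gvgrp \<G> (sproj_v S C). \<forall>x\<in>C. scol_v S (f x) = \<sigma> (scol_v S x))" (is "?l \<longleftrightarrow> ?r")
proof -
  let ?X = "gvset \<G> (sproj_v S C)"
  have bij: "inj_on (scol_v S) C" "scol_v S ` C = ?X"
    using scaf_facts(6)[OF assms] by (auto simp: bij_betw_def)
  have loc: "gga_local_action \<G> S f C (scol_v S x) = scol_v S (f x)" if "x \<in> C" for x
    using that bij by (auto simp: gga_local_action_def)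
  show ?thesis
  proof
    assume ?l
    then show ?r
      using loc by (metis (no_types))
  next
    assume ?r
    then obtain \<sigma> where \<sigma>: "\<sigma> \<in> gvgrp \<G> (sproj_v S C)" "\<forall>x\<in>C. scol_v S (f x) = \<sigma> (scol_v S x)" by blast
    have v: "sproj_v S C \<in> verts (gbase \<G>)" using graph_homD(1)[OF scaf_facts(5) assms] .
    have "gga_local_action \<G> S f C \<in> extensional ?X"
      by (simp add: gga_local_action_def)
    moreover have "\<sigma> \<in> extensional ?X"
      using subgroup_BijGroup_mem[OF gga_facts(3)[OF v] \<sigma>(1)] by (simp add: Bij_iff)
    moreover have "gga_local_action \<G> S f C x = \<sigma> x" if "x \<in> ?X" for x
      using that loc \<sigma>(2) unfolding bij(2)[symmetric] by auto
    ultimately have "gga_local_action \<G> S f C = \<sigma>"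
      by (rule extensionalityI)
    with \<sigma>(1) show ?l by simp
  qed
qed

text \<open>Used in both inclusions to split an equation between labels into its two components. The
  colour of the terminus lies in the orbit belonging to \<open>a\<close>, so the restriction inside
  \<open>disjoint_action\<close> does not interfere.\<close>

lemma arc_terminus_eq_iff:
  assumes b: "b \<in> arcs \<Sigma>" and a: "a \<in> star (gbase \<G>) v" "a = sproj_a S {b}"
  shows "llab labelled {c} = disjoint_action (star (gbase \<G>) v) colours \<sigma> (llab labelled {b}) \<longleftrightarrow>
    sproj_a S {c} = sproj_a S {b} \<and> scol_v S (head \<Sigma> c) = \<sigma> (scol_v S (head \<Sigma> b))"
  using colour_head[OF b] a by (auto simp: disjoint_action_def)

text \<open>The terminus of an arc of a star lies in the class at the centre of that star, so the
  permutation of the colours of this class also tells how the labels of the star move.\<close>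

lemma induced_mem_universal:
  assumes "(f, h) \<in> gga_universal_group \<G> S"
  shows "(\<lambda>C\<in>verts T. f ` C, \<lambda>C\<in>arcs T. h ` C) \<in> lad_universal_group lad labelled"
proof -
  let ?F = "\<lambda>C\<in>verts T. f ` C" and ?H = "\<lambda>C\<in>arcs T. h ` C"
  have f: "f \<in> Bij (verts \<Sigma>)" and h: "h \<in> Bij (arcs \<Sigma>)" and hom: "graph_hom \<Sigma> \<Sigma> f h"
    and rel: "\<And>x y. \<lbrakk>x \<in> verts \<Sigma>; y \<in> verts \<Sigma>\<rbrakk> \<Longrightarrow> (f x, f y) \<in> R \<longleftrightarrow> (x, y) \<in> R"
    and pv: "\<And>C. C \<in> verts T \<Longrightarrow> sproj_v S (f ` C) = sproj_v S C"
    and pa: "\<And>C. C \<in> arcs T \<Longrightarrow> sproj_a S (h ` C) = sproj_a S C"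
    and loc: "\<And>C. C \<in> verts T \<Longrightarrow> \<exists>\<sigma>\<in>gvgrp \<G> (sproj_v S C). \<forall>x\<in>C. scol_v S (f x) = \<sigma> (scol_v S x)"
    using assms gga_local_action_mem_iff by (auto simp: gga_universal_group_def carrier_aut_group)
  note k = graph_homD[OF hom]
  \<comment> \<open>One implication of \<open>rel\<close> sends the class into a class, the converse
    together with surjectivity of \<open>f\<close> makes the image a full class.\<close>
  have cls: "f ` (R `` {x}) = R `` {f x}" if x: "x \<in> verts \<Sigma>" for x
  proof (intro equalityI subsetI)
    fix y assume "y \<in> f ` (R `` {x})"
    then obtain z where "(x, z) \<in> R" "y = f z" by auto
    moreover have "z \<in> verts \<Sigma>" using class_eq(2)[OF class_mem(1)[OF x]] \<open>(x, z) \<in> R\<close> by auto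
    ultimately show "y \<in> R `` {f x}" using rel[OF x] by auto
  next
    fix y assume y: "y \<in> R `` {f x}"
    have "f x \<in> verts \<Sigma>" using Bij_mem[OF f x] .
    then have "y \<in> verts \<Sigma>" using class_eq(2)[OF class_mem(1)] y by blast
    then obtain z where "z \<in> verts \<Sigma>" "y = f z" using f by (auto simp: Bij_iff)
    then show "y \<in> f ` (R `` {x})" using rel[OF x] y by auto
  qed
  have F: "?F (R `` {x}) = R `` {f x}" if "x \<in> verts \<Sigma>" for x
    using that by (simp add: cls class_mem)
  have H: "?H {b} = {h b}" if "b \<in> arcs \<Sigma>" for b
    using that by (simp add: arc_class)
  have verts_img: "verts T = (\<lambda>x. R `` {x}) ` verts \<Sigma>"
    by (auto simp: verts_T quotient_def)
  have "?F \<in> Bij (verts T)"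
  proof -
    have "?F ` verts T = (\<lambda>x. R `` {x}) ` f ` verts \<Sigma>"
      unfolding verts_img image_image using F unfolding verts_img by (intro image_cong) auto
    then have "?F ` verts T = verts T" using f by (simp add: Bij_iff verts_img)
    moreover have "inj_on ?F (verts T)"
    proof (rule inj_onI)
      fix C C' assume "C \<in> verts T" "C' \<in> verts T" "?F C = ?F C'"
      moreover obtain x y where "C = R `` {x}" "C' = R `` {y}" "x \<in> verts \<Sigma>" "y \<in> verts \<Sigma>"
        using calculation(1,2) by (auto simp: verts_img)
      ultimately show "C = C'"
        using rel[of x y] rel_iff[of "f x" "f y"] rel_iff[of x y] Bij_mem[OF f] F[of x] F[of y] by metis
    qed
    ultimately show ?thesis by (simp add: Bij_iff)
  qed
  moreover have "?H \<in> Bij (arcs T)"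
  proof -
    have "?H ` arcs T = (\<lambda>b. {b}) ` h ` arcs \<Sigma>"
      unfolding arcs_T image_image using H unfolding arcs_T by (intro image_cong) auto
    then have "?H ` arcs T = arcs T" using h by (simp add: Bij_iff arcs_T)
    moreover have "inj_on ?H (arcs T)"
    proof (rule inj_onI)
      fix C C' assume "C \<in> arcs T" "C' \<in> arcs T" and eq: "?H C = ?H C'"
      then obtain b c where b: "C = {b}" "C' = {c}" "b \<in> arcs \<Sigma>" "c \<in> arcs \<Sigma>"
        by (auto simp: arcs_T)
      then have "h b = h c" using eq H[of b] H[of c] by simp
      then show "C = C'"
        using b h by (auto simp: Bij_iff dest: inj_onD)
    qed
    ultimately show ?thesis by (simp add: Bij_iff)
  qed
  moreover have "graph_hom T T ?F ?H"
  proof -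
    have "?F C \<in> verts T" if "C \<in> verts T" for C
      using that F Bij_mem[OF f] by (auto simp: verts_img)
    moreover have "?H E \<in> arcs T \<and> tail T (?H E) = ?F (tail T E) \<and> head T (?H E) = ?F (head T E) \<and>
        arev T (?H E) = ?H (arev T E)" if E: "E \<in> arcs T" for E
    proof -
      obtain b where b: "b \<in> arcs \<Sigma>" "E = {b}" using E by (auto simp: arcs_T)
      note g = is_graphD[OF scaf_facts(1) b(1)]
      have "?H E = {h b}" "h b \<in> arcs \<Sigma>" using H b Bij_mem[OF h] by simp_all
      moreover have "?F (tail T E) = R `` {f (tail \<Sigma> b)}" "?F (head T E) = R `` {f (head \<Sigma> b)}"
        unfolding b(2) T_sel using F g by blast+
      moreover have "?H (arev T E) = {h (arev \<Sigma> b)}"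
        unfolding b(2) T_sel using H g by blast
      ultimately show ?thesis
        using k b by (simp add: T_sel arc_class)
    qed
    ultimately show ?thesis by (auto simp: graph_hom_def)
  qed
  moreover have "\<exists>\<sigma>\<in>lgrp lad (sproj_v S C). \<forall>E\<in>star T C. llab labelled (?H E) = \<sigma> (llab labelled E)"
    if C: "C \<in> verts T" for C
  proof -
    obtain \<sigma> where \<sigma>: "\<sigma> \<in> gvgrp \<G> (sproj_v S C)" "\<forall>x\<in>C. scol_v S (f x) = \<sigma> (scol_v S x)"
      using loc[OF C] by blast
    have "llab labelled (?H E) = disjoint_action (star (gbase \<G>) (sproj_v S C)) colours \<sigma> (llab labelled E)"
      if E: "E \<in> star T C" for E
    proof -
      obtain b where b: "b \<in> arcs \<Sigma>" "E = {b}" using E by (auto simp: star_def arcs_T)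
      have "sproj_a S {b} \<in> star (gbase \<G>) (sproj_v S C)"
        using E graph_homD[OF scaf_facts(5)] b by (auto simp: star_def)
      moreover have "head \<Sigma> b \<in> C" using E b head_mem by (auto simp: star_def)
      moreover from this have "sproj_a S {h b} = sproj_a S {b} \<and>
          scol_v S (head \<Sigma> (h b)) = \<sigma> (scol_v S (head \<Sigma> b))"
        using \<sigma>(2) k b(1) pa[OF arc_class(2)[OF b(1)]] by simp
      ultimately show ?thesis
        unfolding b(2) H[OF b(1)] using arc_terminus_eq_iff[OF b(1) _ refl] by blast
    qed
    then show ?thesis using \<sigma>(1) by auto
  qed
  ultimately show ?thesis
    unfolding mem_lad_universal_group_iff[OF is_lad_lad is_associated_tree_labelled] carrier_aut_group
    using pv pa by simp
qed

text \<open>The tree sees only the colours on adhesion sets. For each class an element of the local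
  group inducing the given local action is chosen, and all points of the class follow it, including
  those that are the end of no arc. Different choices may give different lifts of the same tree
  automorphism.\<close>

lemma universal_mem_induced:
  assumes "(F, H) \<in> lad_universal_group lad labelled"
  shows "(F, H) \<in> gga_induced_group \<G> S"
proof -
  have F: "F \<in> Bij (verts T)" and H: "H \<in> Bij (arcs T)" and hom: "graph_hom T T F H"
    and pv: "\<And>C. C \<in> verts T \<Longrightarrow> sproj_v S (F C) = sproj_v S C"
    and pa: "\<And>E. E \<in> arcs T \<Longrightarrow> sproj_a S (H E) = sproj_a S E"
    and loc: "\<And>C. C \<in> verts T \<Longrightarrow> \<exists>\<sigma>\<in>gvgrp \<G> (sproj_v S C). \<forall>E\<in>star T C.
      llab labelled (H E) = disjoint_action (star (gbase \<G>) (sproj_v S C)) colours \<sigma> (llab labelled E)"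
    using assms unfolding mem_lad_universal_group_iff[OF is_lad_lad is_associated_tree_labelled] carrier_aut_group
    by auto
  note k = graph_homD[OF hom] and g = is_graphD[OF scaf_facts(1)]
  obtain \<sigma> where \<sigma>: "\<And>C. C \<in> verts T \<Longrightarrow> \<sigma> C \<in> gvgrp \<G> (sproj_v S C)"
    "\<And>C E. \<lbrakk>C \<in> verts T; E \<in> star T C\<rbrakk> \<Longrightarrow> llab labelled (H E) =
      disjoint_action (star (gbase \<G>) (sproj_v S C)) colours (\<sigma> C) (llab labelled E)"
    using loc by metis
  have \<sigma>_bij: "\<sigma> C \<in> Bij (gvset \<G> (sproj_v S C))" if "C \<in> verts T" for C
    using subgroup_BijGroup_mem[OF gga_facts(3) \<sigma>(1)] that graph_homD(1)[OF scaf_facts(5)] by blast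
  have inj: "inj_on F (verts T)" "inj_on H (arcs T)" and im: "F ` verts T = verts T" "H ` arcs T = arcs T"
    using F H by (auto simp: Bij_iff)
  define h where "h = (\<lambda>b\<in>arcs \<Sigma>. the_elem (H {b}))"
  \<comment> \<open>Within the target class a point is determined by its colour, so it is enough to
    prescribe the colour through \<open>\<sigma>\<close>.\<close>
  define f where "f = (\<lambda>x\<in>verts \<Sigma>. inv_into (F (R `` {x})) (scol_v S) (\<sigma> (R `` {x}) (scol_v S x)))"
  have h: "H {b} = {h b}" "h b \<in> arcs \<Sigma>" if "b \<in> arcs \<Sigma>" for b
  proof -
    have "H {b} \<in> (\<lambda>b. {b}) ` arcs \<Sigma>"
      using Bij_mem[OF H arc_class(2)[OF that]] unfolding arcs_T .
    then obtain c where "c \<in> arcs \<Sigma>" "H {b} = {c}" by blast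
    with that show "H {b} = {h b}" "h b \<in> arcs \<Sigma>" by (simp_all add: h_def)
  qed
  have FC: "F C \<in> verts T" if "C \<in> verts T" for C using Bij_mem[OF F that] .
  have col: "bij_betw (scol_v S) (F C) (gvset \<G> (sproj_v S C))" if "C \<in> verts T" for C
    using scaf_facts(6)[OF FC[OF that]] pv[OF that] by simp
  have f_mem: "f x \<in> F C" "scol_v S (f x) = \<sigma> C (scol_v S x)" if C: "C \<in> verts T" and x: "x \<in> C" for x C
  proof -
    note c = class_eq[OF C]
    have "scol_v S x \<in> gvset \<G> (sproj_v S C)" using scaf_facts(6)[OF C] x by (auto simp: bij_betw_def)
    then have "\<sigma> C (scol_v S x) \<in> scol_v S ` F C"
      using Bij_mem[OF \<sigma>_bij[OF C]] col[OF C] by (auto simp: bij_betw_def)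
    moreover have "f x = inv_into (F C) (scol_v S) (\<sigma> C (scol_v S x))"
      using c(1,2)[OF x] by (simp add: f_def)
    ultimately show "f x \<in> F C" "scol_v S (f x) = \<sigma> C (scol_v S x)"
      by (simp_all add: inv_into_into f_inv_into_f)
  qed
  have f_img: "f ` C = F C" if C: "C \<in> verts T" for C
  proof
    show "f ` C \<subseteq> F C" using f_mem[OF C] by auto
    show "F C \<subseteq> f ` C"
    proof
      fix y assume y: "y \<in> F C"
      then have "scol_v S y \<in> gvset \<G> (sproj_v S C)" using col[OF C] by (auto simp: bij_betw_def)
      then obtain z where "z \<in> gvset \<G> (sproj_v S C)" "scol_v S y = \<sigma> C z"
        using \<sigma>_bij[OF C] by (auto simp: Bij_iff)
      moreover obtain x where "x \<in> C" "z = scol_v S x"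
        using scaf_facts(6)[OF C] calculation(1) by (auto simp: bij_betw_def)
      ultimately have "scol_v S (f x) = scol_v S y" using f_mem(2)[OF C] by simp
      then have "f x = y"
        using col[OF C] f_mem(1)[OF C \<open>x \<in> C\<close>] y by (auto simp: bij_betw_def dest: inj_onD)
      with \<open>x \<in> C\<close> show "y \<in> f ` C" by auto
    qed
  qed
  have f_class: "f x \<in> verts \<Sigma>" "R `` {f x} = F (R `` {x})" if "x \<in> verts \<Sigma>" for x
    using f_mem(1)[OF class_mem[OF that]] class_eq[OF FC[OF class_mem(1)[OF that]]] by auto
  have f_rel: "R `` {f x} = R `` {f y} \<longleftrightarrow> R `` {x} = R `` {y}" if "x \<in> verts \<Sigma>" "y \<in> verts \<Sigma>" for x y
    using F that class_mem(1) by (auto simp: f_class Bij_iff dest: inj_onD)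
  have "f \<in> Bij (verts \<Sigma>)"
  proof -
    have "inj_on f (verts \<Sigma>)"
    proof (rule inj_onI)
      fix x y assume x: "x \<in> verts \<Sigma>" and y: "y \<in> verts \<Sigma>" and eq: "f x = f y"
      let ?C = "R `` {x}"
      have C: "?C \<in> verts T" "x \<in> ?C" using class_mem x by auto
      have "R `` {y} = ?C" using f_rel[OF x y] eq by simp
      then have yC: "y \<in> ?C" using class_mem(2)[OF y] by simp
      have in_set: "scol_v S z \<in> gvset \<G> (sproj_v S ?C)" if "z \<in> ?C" for z
        using scaf_facts(6)[OF C(1)] that by (auto simp: bij_betw_def)
      have "\<sigma> ?C (scol_v S x) = \<sigma> ?C (scol_v S y)"
        using f_mem(2)[OF C] f_mem(2)[OF C(1) yC] eq by simp
      then have "scol_v S x = scol_v S y"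
        using \<sigma>_bij[OF C(1)] in_set[OF C(2)] in_set[OF yC] by (auto simp: Bij_iff dest: inj_onD)
      then show "x = y"
        using scaf_facts(6)[OF C(1)] C(2) yC by (auto simp: bij_betw_def dest: inj_onD)
    qed
    moreover have "f ` verts \<Sigma> = verts \<Sigma>"
    proof (intro equalityI subsetI)
      fix y assume y: "y \<in> verts \<Sigma>"
      obtain C where C: "C \<in> verts T" "F C = R `` {y}"
        using class_mem(1)[OF y] im(1) by (metis (no_types) imageE)
      have "y \<in> f ` C" using f_img[OF C(1)] C(2) class_mem(2)[OF y] by simp
      then show "y \<in> f ` verts \<Sigma>" using class_eq(2)[OF C(1)] by auto
    qed (auto simp: f_class)
    ultimately show ?thesis by (simp add: Bij_iff f_def)
  qed
  moreover have "h \<in> Bij (arcs \<Sigma>)"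
  proof -
    have "inj_on h (arcs \<Sigma>)"
    proof (rule inj_onI)
      fix b c assume b: "b \<in> arcs \<Sigma>" and c: "c \<in> arcs \<Sigma>" and "h b = h c"
      then have "H {b} = H {c}" by (simp add: h)
      then show "b = c" using inj_onD[OF inj(2) _ arc_class(2)[OF b] arc_class(2)[OF c]] by simp
    qed
    moreover have "h ` arcs \<Sigma> = arcs \<Sigma>"
    proof (intro equalityI subsetI)
      fix c assume c: "c \<in> arcs \<Sigma>"
      obtain E where E: "E \<in> arcs T" "H E = {c}"
        using arc_class(2)[OF c] im(2) by (metis (no_types) imageE)
      then obtain b where "b \<in> arcs \<Sigma>" "E = {b}" by (auto simp: arcs_T)
      then show "c \<in> h ` arcs \<Sigma>" using E(2) h by auto
    qed (auto simp: h)
    ultimately show ?thesis by (simp add: Bij_iff h_def)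
  qed
  moreover have "graph_hom \<Sigma> \<Sigma> f h"
  proof -
    have rev: "arev \<Sigma> (h b) = h (arev \<Sigma> b)" if b: "b \<in> arcs \<Sigma>" for b
    proof -
      have "{h (arev \<Sigma> b)} = H (arev T {b})" using h[OF g(3)[OF b]] by (simp add: T_sel)
      also have "\<dots> = {arev \<Sigma> (h b)}" using k(5)[OF arc_class(2)[OF b]] by (simp add: h[OF b] T_sel)
      finally show ?thesis by simp
    qed
    \<comment> \<open>The only place where the lift has to fit the arcs: both sides lie in the class
      \<open>F ?C\<close> and have the same colour, and the colouring is injective on a
      class.\<close>
    have hd: "head \<Sigma> (h b) = f (head \<Sigma> b)" if b: "b \<in> arcs \<Sigma>" for b
    proof -
      let ?C = "head T {b}"
      have C: "?C \<in> verts T" using is_graphD[OF scaf_facts(4) arc_class(2)[OF b]] by blast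
      have E: "{b} \<in> star T ?C" using arc_class(2)[OF b] by (simp add: star_def)
      have a: "sproj_a S {b} \<in> star (gbase \<G>) (sproj_v S ?C)"
        using graph_homD[OF scaf_facts(5)] arc_class(2)[OF b] by (simp add: star_def)
      have "head \<Sigma> (h b) \<in> F ?C"
        using head_mem[OF h(2)[OF b]] k(4)[OF arc_class(2)[OF b]] by (simp add: h[OF b])
      moreover have "scol_v S (head \<Sigma> (h b)) = \<sigma> ?C (scol_v S (head \<Sigma> b))"
        using \<sigma>(2)[OF C E] arc_terminus_eq_iff[OF b a refl] unfolding h(1)[OF b] by blast
      ultimately show ?thesis
        using inj_onD[OF bij_betw_imp_inj_on[OF col[OF C]]] f_mem[OF C head_mem[OF b]] by simp
    qed
    \<comment> \<open>An origin is the terminus of the reverse arc, so no second comparison of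
      colours is made.\<close>
    have "tail \<Sigma> (h b) = f (tail \<Sigma> b)" if b: "b \<in> arcs \<Sigma>" for b
      using hd[OF g(3)[OF b]] rev[OF b] g[OF b] g[OF h(2)[OF b]] by simp
    with rev hd show ?thesis by (simp add: graph_hom_def f_class h)
  qed
  moreover have "(f x, f y) \<in> R \<longleftrightarrow> (x, y) \<in> R" if "x \<in> verts \<Sigma>" "y \<in> verts \<Sigma>" for x y
    using f_rel[OF that] that by (simp add: rel_iff f_class(1))
  moreover have "gga_local_action \<G> S f C \<in> gvgrp \<G> (sproj_v S C)" if C: "C \<in> verts T" for C
    unfolding gga_local_action_mem_iff[OF C] using f_mem(2)[OF C] \<sigma>(1)[OF C] by blast
  moreover have h_img: "h ` E = H E" if "E \<in> arcs T" for E
    using that by (auto simp: arcs_T h)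
  ultimately have "(f, h) \<in> gga_universal_group \<G> S"
    by (simp add: gga_universal_group_def carrier_aut_group f_img pv pa)
  moreover have "(\<lambda>C\<in>verts T. f ` C) = F"
    using F f_img by (auto simp: Bij_iff intro!: extensionalityI[of _ "verts T"])
  moreover have "(\<lambda>E\<in>arcs T. h ` E) = H"
    using H h_img by (auto simp: Bij_iff intro!: extensionalityI[of _ "arcs T"])
  ultimately show ?thesis
    unfolding gga_induced_group_def by (force intro: image_eqI[of _ _ "(f, h)"])
qed

lemma gga_induced_group_eq: "gga_induced_group \<G> S = lad_universal_group lad labelled"
  using induced_mem_universal universal_mem_induced by (auto simp: gga_induced_group_def)

end

section \<open>The free graph of group actions of a diagram\<close>

text \<open>Orbits partition the colours, so the orbit that contains \<open>(a, x)\<close> is the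
  orbit of \<open>(a, x)\<close>. Any colour of \<open>a\<close> can therefore be a base point, in
  particular the arbitrary one picked for \<open>gemb\<close> below.\<close>

lemma lad_orbit:
  assumes D: "is_lad D" and v: "v \<in> verts (lbase D)" and a: "a \<in> star (lbase D) v"
  shows "lcol D a \<noteq> {}"
    and "x \<in> lcol D a \<Longrightarrow> (\<lambda>\<sigma>. \<sigma> (a, x)) ` lgrp D v = {a} \<times> lcol D a"
proof -
  let ?G = "(BijGroup (lad_colours D v))\<lparr>carrier := lgrp D v\<rparr>" and ?X = "lad_colours D v"
  note sub = is_ladD(3)[OF D v]
  have "(\<lambda>g. g) \<in> hom ?G (BijGroup ?X)"
    using subgroup_BijGroup_mem[OF sub] by (auto intro!: homI)
  then interpret group_action ?G ?X "\<lambda>g. g"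
    using subgroup.subgroup_is_group[OF sub group_BijGroup]
    by (simp add: group_action_def group_hom_def group_hom_axioms_def group_BijGroup)
  have orb: "{a} \<times> lcol D a \<in> orbits ?G ?X (\<lambda>g. g)" using is_ladD(4)[OF D v a] .
  then obtain z where z: "z \<in> ?X" "{a} \<times> lcol D a = orbit ?G (\<lambda>g. g) z" by (auto simp: orbits_def)
  have "z \<in> {a} \<times> lcol D a" using orbit_refl[OF z(1)] z(2) by blast
  then show "lcol D a \<noteq> {}" by auto
  show "(\<lambda>\<sigma>. \<sigma> (a, x)) ` lgrp D v = {a} \<times> lcol D a" if x: "x \<in> lcol D a"
  proof -
    have ax: "(a, x) \<in> ?X" using x a by (simp add: lad_colours_def)
    then have "orbit ?G (\<lambda>g. g) (a, x) \<in> orbits ?G ?X (\<lambda>g. g)" by (auto simp: orbits_def)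
    moreover have "(a, x) \<in> orbit ?G (\<lambda>g. g) (a, x)" by (rule orbit_refl[OF ax])
    moreover have "\<exists>!B. B \<in> orbits ?G ?X (\<lambda>g. g) \<and> (a, x) \<in> B"
      using orbit_partition ax by (auto simp: partition_def)
    ultimately have "orbit ?G (\<lambda>g. g) (a, x) = {a} \<times> lcol D a"
      using orb x by blast
    then show ?thesis by (simp add: orbit_def Setcompr_eq_image)
  qed
qed

section \<open>Trivial actions on one-element sets\<close>

lemma compose_id_singleton: "compose {z} (\<lambda>y\<in>{z}. y) (\<lambda>y\<in>{z}. y) = (\<lambda>y\<in>{z}. y)"
  by (rule ext) (simp add: compose_def)

lemma perm_group_action_trivial: "perm_group_action {\<lambda>y\<in>{z}. y} {z}"
  using group.triv_subgroup[OF group_BijGroup, of "{z}"] by (simp add: perm_group_action_def one_BijGroup)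

lemma induced_perms_singleton:
  assumes "subgroup H (BijGroup X)" "z \<in> X"
  shows "induced_perms H {z} = {\<lambda>x\<in>{z}. x}"
proof
  show "induced_perms H {z} \<subseteq> {\<lambda>x\<in>{z}. x}"
  proof
    fix k assume "k \<in> induced_perms H {z}"
    then obtain g where "k = restrict g {z}" "g ` {z} = {z}" by (auto simp: induced_perms_def)
    then show "k \<in> {\<lambda>x\<in>{z}. x}" by (simp add: fun_eq_iff restrict_def)
  qed
  have 1: "(\<lambda>x\<in>X. x) \<in> H"
    using subgroup.one_closed[OF assms(1)] by (simp add: one_BijGroup)
  have 2: "(\<lambda>x\<in>{z}. x) = restrict (\<lambda>x\<in>X. x) {z}" "(\<lambda>x\<in>X. x) ` {z} = {z}"
    using assms(2) by (simp_all add: restrict_def fun_eq_iff)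
  show "{\<lambda>x\<in>{z}. x} \<subseteq> induced_perms H {z}"
    unfolding induced_perms_def 2(1) using 1 2(2) by blast
qed

text \<open>The stabiliser of a point induces only the identity on that point, so an embedding of
  the trivial action amounts to the choice of a point of \<open>X\<close>.\<close>

lemma action_embedding_trivial:
  assumes "subgroup H (BijGroup X)" "\<Phi> y \<in> X"
  shows "action_embedding \<Phi> {\<lambda>x\<in>{y}. x} {y} H X"
proof -
  define c where "c = (\<lambda>h. \<lambda>x\<in>\<Phi> ` {y}. \<Phi> (h (inv_into {y} \<Phi> x)))"
  have c: "c (\<lambda>x\<in>{y}. x) = (\<lambda>x\<in>{\<Phi> y}. x)"
    by (simp add: c_def restrict_def fun_eq_iff)
  have "c \<in> iso ((BijGroup {y})\<lparr>carrier := {\<lambda>x\<in>{y}. x}\<rparr>) ((BijGroup {\<Phi> y})\<lparr>carrier := {\<lambda>x\<in>{\<Phi> y}. x}\<rparr>)"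
  proof (rule isoI)
    show "c \<in> hom ((BijGroup {y})\<lparr>carrier := {\<lambda>x\<in>{y}. x}\<rparr>) ((BijGroup {\<Phi> y})\<lparr>carrier := {\<lambda>x\<in>{\<Phi> y}. x}\<rparr>)"
      by (rule homI) (simp_all add: c mult_BijGroup[OF id_Bij id_Bij] compose_id_singleton)
  qed (simp add: c bij_betw_def)
  then show ?thesis
    using induced_perms_singleton[OF assms] assms(2) by (simp add: action_embedding_def c_def)
qed

text \<open>Vertices and arcs of the tree share one type, so that both can be points of the same
  scaffolding. \<open>pt\<close> is going to be the colour of the additional point, and
  \<open>y0\<close> the only element of every set Y(a).\<close>

locale disjoint_lad =
  fixes D :: "('a, 'b, 'x) local_action_diagram" and A :: "('c, 'c, 'a, 'b, 'x) labelled_tree"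
    and pt :: 'x and y0 :: 'y
  assumes D: "is_lad D" and A: "is_associated_tree D A"
    and disjoint: "verts (ltree A) \<inter> arcs (ltree A) = {}"
    and lcol_disjoint: "\<And>a b. \<lbrakk>a \<in> arcs (lbase D); b \<in> arcs (lbase D); a \<noteq> b\<rbrakk> \<Longrightarrow> lcol D a \<inter> lcol D b = {}"
    and pt: "\<And>a. a \<in> arcs (lbase D) \<Longrightarrow> pt \<notin> lcol D a"
begin

abbreviation "T \<equiv> ltree A"

text \<open>The additional point keeps the sets acted upon non-empty when the tree has a single vertex.\<close>

definition vset :: "'a \<Rightarrow> 'x set" where
  "vset v = insert pt (snd ` lad_colours D v)"

text \<open>The additional point is fixed by the extended groups, hence an orbit of its own that
  meets no adhesion set. The colour picked by \<open>SOME\<close> is arbitrary: its orbit is the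
  whole colour set of the arc.\<close>

definition \<G> :: "('a, 'b, 'x, 'y) gga" where
  "\<G> = \<lparr>gbase = lbase D, gvset = vset,
     gvgrp = (\<lambda>v. extend_perm snd (lad_colours D v) (vset v) ` lgrp D v),
     gaset = (\<lambda>a. {y0}), gagrp = (\<lambda>a. {\<lambda>y\<in>{y0}. y}),
     gemb = (\<lambda>a y. SOME x. x \<in> lcol D a), gtwist = (\<lambda>a. \<lambda>y\<in>{y0}. y)\<rparr>"

lemma \<G>_sel [simp]:
  "gbase \<G> = lbase D" "gvset \<G> = vset"
  "gvgrp \<G> v = extend_perm snd (lad_colours D v) (vset v) ` lgrp D v"
  "gaset \<G> a = {y0}" "gagrp \<G> a = {\<lambda>y\<in>{y0}. y}" "gtwist \<G> a = (\<lambda>y\<in>{y0}. y)"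
  "gemb \<G> a y = (SOME x. x \<in> lcol D a)"
  by (simp_all add: \<G>_def)

text \<open>Disjointness of the colour sets lets a colour determine its arc, so the formal disjoint
  union can be replaced by the plain union.\<close>

lemma inj_snd: "inj_on snd (lad_colours D v)"
proof (rule inj_onI)
  fix s t assume "s \<in> lad_colours D v" "t \<in> lad_colours D v" "snd s = snd t"
  moreover from this have "fst s = fst t"
    using lcol_disjoint[of "fst s" "fst t"] by (force simp: lad_colours_def star_def)
  ultimately show "s = t" by (simp add: prod_eq_iff)
qed

lemma snd_vset: "snd ` lad_colours D v \<subseteq> vset v"
  by (auto simp: vset_def)

lemma extend_snd: "z \<in> lad_colours D v \<Longrightarrow> extend_perm snd (lad_colours D v) (vset v) \<sigma> (snd z) = snd (\<sigma> z)"
  by (rule extend_perm_apply[OF inj_snd snd_vset])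

lemma emb_mem:
  assumes "a \<in> arcs (lbase D)"
  shows "gemb \<G> a y \<in> lcol D a"
proof -
  have "lcol D a \<noteq> {}"
    using lad_orbit(1)[OF D _, of "head (lbase D) a" a] is_graphD[OF is_ladD(2)[OF D] assms] assms
    by (simp add: star_def)
  then show ?thesis by (auto intro: someI)
qed

lemma is_free_gga: "is_free_gga \<G>"
proof -
  note g = is_graphD[OF is_ladD(2)[OF D]]
  have perm: "perm_group_action (gvgrp \<G> v) (gvset \<G> v)" if v: "v \<in> verts (lbase D)" for v
    using subgroup_hom_image[OF extend_perm_hom[OF inj_snd snd_vset] is_ladD(3)[OF D v]]
    by (simp add: perm_group_action_def vset_def)
  have emb: "action_embedding (gemb \<G> a) (gagrp \<G> a) (gaset \<G> a)
      (gvgrp \<G> (head (lbase D) a)) (gvset \<G> (head (lbase D) a))" if a: "a \<in> arcs (lbase D)" for a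
  proof -
    let ?v = "head (lbase D) a"
    have v: "?v \<in> verts (lbase D)" using g[OF a] by simp
    have "(a, gemb \<G> a y0) \<in> lad_colours D ?v"
      using emb_mem[OF a, of y0] a by (simp add: lad_colours_def star_def)
    then have "snd (a, gemb \<G> a y0) \<in> snd ` lad_colours D ?v" by (rule imageI)
    then have z: "gemb \<G> a y0 \<in> gvset \<G> ?v"
      by (simp add: vset_def)
    have "subgroup (gvgrp \<G> ?v) (BijGroup (gvset \<G> ?v))"
      using perm[OF v] by (simp add: perm_group_action_def)
    from action_embedding_trivial[of _ _ "gemb \<G> a" y0, OF this z] show ?thesis
      by simp
  qed
  have "\<one>\<^bsub>BijGroup {y0}\<^esub> = (\<lambda>y\<in>{y0}. y)" by (rule one_BijGroup)
  moreover have "inv\<^bsub>BijGroup {y0}\<^esub> (\<lambda>y\<in>{y0}. y) = (\<lambda>y\<in>{y0}. y)"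
    using monoid.inv_one[OF group.is_monoid[OF group_BijGroup[of "{y0}"]]] by (simp add: one_BijGroup)
  ultimately show ?thesis
    using is_ladD(1)[OF D] perm perm_group_action_trivial[of y0] emb id_Bij[of "{y0}"]
    by (simp add: is_free_gga_def is_gga_def Let_def mult_BijGroup[OF id_Bij id_Bij] compose_id_singleton)
qed

sublocale free_gga \<G>
  by unfold_locales (rule is_free_gga)

text \<open>On the old colours the extended permutations act as before, so the orbit of the chosen
  representative is the orbit prescribed by \<open>D\<close>.\<close>

lemma colours_lcol:
  assumes "a \<in> arcs (lbase D)"
  shows "colours a = lcol D a"
proof -
  let ?v = "head (lbase D) a"
  have v: "?v \<in> verts (lbase D)" "a \<in> star (lbase D) ?v"
    using is_graphD[OF is_ladD(2)[OF D] assms] assms by (simp_all add: star_def)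
  have pm: "point a \<in> lcol D a" using emb_mem[OF assms] by (simp add: point_def)
  have "colours a = (\<lambda>\<sigma>. extend_perm snd (lad_colours D ?v) (vset ?v) \<sigma> (snd (a, point a))) ` lgrp D ?v"
    using colours_eq[of a] assms by (simp add: image_image)
  also have "\<dots> = snd ` (\<lambda>\<sigma>. \<sigma> (a, point a)) ` lgrp D ?v"
    using v pm by (subst extend_snd) (auto simp: lad_colours_def image_image)
  also have "\<dots> = lcol D a"
    unfolding lad_orbit(2)[OF D v pm] by auto
  finally show ?thesis .
qed

lemma lgrp_fst:
  assumes v: "v \<in> verts (lbase D)" and "\<sigma> \<in> lgrp D v" "z \<in> lad_colours D v"
  shows "fst (\<sigma> z) = fst z"
proof -
  obtain a x where z: "z = (a, x)" by (cases z)
  then have "a \<in> star (lbase D) v" "x \<in> lcol D a" using assms(3) by (auto simp: lad_colours_def)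
  then have "\<sigma> (a, x) \<in> {a} \<times> lcol D a"
    using imageI[OF assms(2), of "\<lambda>\<sigma>. \<sigma> (a, x)"] lad_orbit(2)[OF D v] by blast
  then show ?thesis using z by auto
qed

lemma lad_colours_eq: "lad_colours lad v = lad_colours D v"
  unfolding lad_colours_lad lad_colours_def by (rule Sigma_cong) (auto simp: star_def colours_lcol)

text \<open>Extending by a fixed point and then restricting to the orbits gives back each
  permutation. With \<open>colours_lcol\<close> this closes the circle: the diagram attached to
  \<open>\<G>\<close> agrees with \<open>D\<close> on the base graph.\<close>

lemma lgrp_lad:
  assumes v: "v \<in> verts (lbase D)"
  shows "lgrp lad v = lgrp D v"
proof -
  let ?X = "lad_colours D v"
  have "disjoint_action (star (lbase D) v) colours (extend_perm snd ?X (vset v) \<sigma>) = \<sigma>"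
    if \<sigma>: "\<sigma> \<in> lgrp D v" for \<sigma>
  proof -
    have dom: "Sigma (star (lbase D) v) colours = ?X"
      using lad_colours_eq[of v] by (simp add: lad_colours_lad)
    show ?thesis
    proof (rule extensionalityI[of _ ?X])
      show "\<sigma> \<in> extensional ?X"
        using subgroup_BijGroup_mem[OF is_ladD(3)[OF D v] \<sigma>] by (simp add: Bij_iff)
      fix z assume z: "z \<in> ?X"
      show "disjoint_action (star (lbase D) v) colours (extend_perm snd ?X (vset v) \<sigma>) z = \<sigma> z"
        unfolding disjoint_action_def dom using z lgrp_fst[OF v \<sigma> z] by (simp add: extend_snd prod_eq_iff)
    qed (simp add: disjoint_action_def dom)
  qed
  then show ?thesis by (simp add: image_image)
qed

text \<open>
  The scaffolding has the vertices and the arcs of the tree as vertices; the class of v consists of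
  v, which carries the additional point, and of the arcs of its star.
\<close>

definition \<kappa> :: "'c \<Rightarrow> 'c" where
  "\<kappa> x = (if x \<in> arcs T then head T x else x)"

text \<open>Letting the arc \<open>b\<close> end at the point \<open>b\<close> gives distinct arcs
  of a star distinct ends, each of which can carry the label of its arc as colour; reversal then
  dictates the origin. The projections recover the tree vertex or tree arc from its class.\<close>

definition scaff :: "('c, 'c, 'a, 'b, 'x, 'y) scaffolding" where
  "scaff = \<lparr>sgraph = \<lparr>verts = verts T \<union> arcs T, arcs = arcs T, tail = arev T, head = (\<lambda>b. b), arev = arev T\<rparr>,
     srel = {(x, y). x \<in> verts T \<union> arcs T \<and> y \<in> verts T \<union> arcs T \<and> \<kappa> x = \<kappa> y},
     sproj_v = (\<lambda>C. lproj_v A (the_elem (\<kappa> ` C))), sproj_a = (\<lambda>E. lproj_a A (the_elem E)),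
     scol_v = (\<lambda>x. if x \<in> verts T then pt else snd (llab A x)), scol_a = (\<lambda>b. y0)\<rparr>"

lemma scaff_sel [simp]:
  "verts (sgraph scaff) = verts T \<union> arcs T" "arcs (sgraph scaff) = arcs T"
  "tail (sgraph scaff) = arev T" "head (sgraph scaff) = (\<lambda>b. b)" "arev (sgraph scaff) = arev T"
  "srel scaff = {(x, y). x \<in> verts T \<union> arcs T \<and> y \<in> verts T \<union> arcs T \<and> \<kappa> x = \<kappa> y}"
  "sproj_a scaff {b} = lproj_a A b" "scol_a scaff b = y0"
  "scol_v scaff x = (if x \<in> verts T then pt else snd (llab A x))"
  by (simp_all add: scaff_def)

lemmas tree = is_associated_treeD[OF A]
lemmas tree_graph = is_graphD[OF tree(2)]
lemmas proj = graph_homD[OF tree(3)]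

lemma \<kappa>_simps: "b \<in> arcs T \<Longrightarrow> \<kappa> b = head T b" "v \<in> verts T \<Longrightarrow> \<kappa> v = v"
  using disjoint by (auto simp: \<kappa>_def)

definition cls :: "'c \<Rightarrow> 'c set" where
  "cls v = insert v (star T v)"

lemma srel_image:
  assumes "x \<in> verts T \<union> arcs T"
  shows "srel scaff `` {x} = cls (\<kappa> x)"
proof (rule Set.set_eqI)
  fix y
  have "head T b \<notin> arcs T" if "b \<in> arcs T" for b
    using tree_graph(2)[OF that] disjoint by auto
  then show "y \<in> srel scaff `` {x} \<longleftrightarrow> y \<in> cls (\<kappa> x)"
    using assms by (cases "y \<in> arcs T"; cases "y \<in> verts T"; cases "x \<in> arcs T")
      (auto simp: cls_def star_def \<kappa>_simps tree_graph)
qed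

lemma srel_arcs: "b \<in> arcs T \<Longrightarrow> srel scaff `` {b} = cls (head T b)"
  by (simp only: srel_image UnI2 \<kappa>_simps)

lemma sproj_v_cls: "v \<in> verts T \<Longrightarrow> sproj_v scaff (cls v) = lproj_v A v"
proof -
  assume v: "v \<in> verts T"
  have "\<kappa> ` cls v = {v}" using v by (auto simp: cls_def star_def \<kappa>_simps)
  then show ?thesis by (simp add: scaff_def)
qed

lemma equiv_srel: "equiv (verts T \<union> arcs T) (srel scaff)"
  by (rule equivI) (auto simp: refl_on_def sym_def trans_def)

lemma verts_quotient: "verts (scaf_tree scaff) = cls ` verts T"
proof -
  have "verts (scaf_tree scaff) = (\<lambda>x. srel scaff `` {x}) ` (verts T \<union> arcs T)"
    by (simp only: scaf_tree_def quotient_graph_def quotient_def scaff_sel) auto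
  also have "\<dots> = (\<lambda>x. cls (\<kappa> x)) ` (verts T \<union> arcs T)"
    by (intro image_cong refl srel_image)
  also have "\<dots> = cls ` verts T"
    by (auto simp: \<kappa>_simps tree_graph image_Un)
  finally show ?thesis .
qed

text \<open>Arcs in one class have the same origin and the same terminus in the tree, which has no
  multiple arcs.\<close>

lemma arc_rel_image: "b \<in> arcs T \<Longrightarrow> arc_rel (sgraph scaff) (srel scaff) `` {b} = {b}"
  using is_treeD(5)[OF tree(1)] by (auto simp: arc_rel_def tree_graph \<kappa>_simps)

lemma arcs_quotient: "arcs (scaf_tree scaff) = (\<lambda>b. {b}) ` arcs T"
proof -
  have "arcs (scaf_tree scaff) = (\<lambda>b. arc_rel (sgraph scaff) (srel scaff) `` {b}) ` arcs T"
    by (simp only: scaf_tree_def quotient_graph_def quotient_def scaff_sel) auto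
  also have "\<dots> = (\<lambda>b. {b}) ` arcs T"
    by (intro image_cong refl arc_rel_image)
  finally show ?thesis .
qed

lemma quotient_sel:
  assumes "b \<in> arcs T"
  shows "tail (scaf_tree scaff) {b} = cls (tail T b)" "head (scaf_tree scaff) {b} = cls (head T b)"
    "arev (scaf_tree scaff) {b} = {arev T b}"
proof -
  have "tail (scaf_tree scaff) {b} = srel scaff `` {arev T b}" "head (scaf_tree scaff) {b} = srel scaff `` {b}"
    "arev (scaf_tree scaff) {b} = {arev T b}"
    by (simp_all only: scaf_tree_def quotient_graph_def rgraph.simps pre_digraph.simps scaff_sel image_insert image_empty)
  then show "tail (scaf_tree scaff) {b} = cls (tail T b)" "head (scaf_tree scaff) {b} = cls (head T b)"
    "arev (scaf_tree scaff) {b} = {arev T b}"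
    using assms by (simp_all only: srel_arcs tree_graph)
qed

lemma inj_cls: "inj_on cls (verts T)"
proof (rule inj_onI)
  fix u v assume u: "u \<in> verts T" and v: "v \<in> verts T" and "cls u = cls v"
  then have "u \<in> cls v" by (auto simp: cls_def)
  then show "u = v" using u disjoint by (auto simp: cls_def star_def)
qed

lemma graph_iso_quotient: "graph_iso T (scaf_tree scaff) cls (\<lambda>b. {b})"
  using inj_cls by (auto simp: graph_iso_def graph_hom_def bij_betw_def verts_quotient arcs_quotient
      quotient_sel tree_graph)

lemma star_quotient: "v \<in> verts T \<Longrightarrow> star (scaf_tree scaff) (cls v) = (\<lambda>b. {b}) ` star T v"
  by (rule graph_iso_star[OF tree(2) graph_iso_quotient])

lemma psi_quotient:
  assumes "b \<in> arcs T"
  shows "scaf_psi \<G> scaff {b} = (\<lambda>y\<in>{y0}. snd (llab A b))"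
proof -
  have "b \<notin> verts T" using assms disjoint by auto
  moreover have "inv_into {b} (scol_a scaff) y0 = b"
    using inv_into_into[of y0 "scol_a scaff" "{b}"] by simp
  ultimately show ?thesis
    by (simp add: scaf_psi_def restrict_def fun_eq_iff)
qed

lemma psi_quotient_adhesion:
  assumes b: "b \<in> arcs T"
  shows "scaf_psi \<G> scaff {b} \<in> adhesion_maps \<G> (lproj_a A b)"
proof -
  let ?a = "lproj_a A b"
  have a: "?a \<in> arcs (lbase D)" using proj b by blast
  have "snd (llab A b) \<in> colours ?a" using llab_mem(2)[OF A b] colours_lcol[OF a] by simp
  then obtain g where "g \<in> gvgrp \<G> (head (lbase D) ?a)" "snd (llab A b) = g (point ?a)"
    using colours_eq[of ?a] a by auto
  then show ?thesis
    using adhesion_maps_eq[of ?a] a by (auto simp: psi_quotient[OF b])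
qed

text \<open>The star uses up the old colours through its labels, and the centre takes
  \<open>pt\<close>, which is not among them.\<close>

lemma bij_betw_scol_v:
  assumes v: "v \<in> verts T"
  shows "bij_betw (scol_v scaff) (cls v) (vset (lproj_v A v))"
proof -
  let ?X = "lad_colours D (lproj_v A v)"
  have star: "b \<notin> verts T" if "b \<in> star T v" for b using that disjoint by (auto simp: star_def)
  have "bij_betw (snd \<circ> llab A) (star T v) (snd ` ?X)"
    by (rule bij_betw_trans[OF bij_betw_llab[OF A v]]) (rule inj_on_imp_bij_betw[OF inj_snd])
  then have "bij_betw (scol_v scaff) (star T v) (snd ` ?X)"
    by (subst bij_betw_cong[of _ _ "snd \<circ> llab A"]) (simp_all add: star)
  moreover have "v \<notin> star T v" using star v by blast
  moreover have "scol_v scaff v \<notin> snd ` ?X" using v pt by (auto simp: lad_colours_def star_def)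
  ultimately show ?thesis
    using v notIn_Un_bij_betw[of v "star T v" "scol_v scaff" "snd ` ?X"]
    by (simp add: cls_def vset_def)
qed

text \<open>An adhesion set is \<open>{x}\<close> with \<open>x\<close> a colour of
  \<open>a\<close>; the arc looked for is the one in the star of \<open>v\<close> with label
  \<open>(a, x)\<close>.\<close>

lemma ex1_quotient:
  assumes v: "v \<in> verts T" and a: "a \<in> star (lbase D) (lproj_v A v)" and Z: "Z \<in> adhesion_sets \<G> a"
  shows "\<exists>!E. E \<in> star (scaf_tree scaff) (cls v) \<and> sproj_a scaff E = a \<and> scaf_psi \<G> scaff E ` gaset \<G> a = Z"
proof -
  have a': "a \<in> arcs (lbase D)" "head (lbase D) a = lproj_v A v" using a by (simp_all add: star_def)
  obtain x where x: "Z = {x}" "x \<in> lcol D a"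
    using Z adhesion_sets_eq[of a] colours_lcol a' by auto
  have bij: "bij_betw (llab A) {b \<in> star T v. lproj_a A b = a} ({a} \<times> lcol D a)"
    by (rule tree(6)[OF v a'])
  have lab: "llab A b = (a, snd (llab A b))" if "b \<in> star T v" "lproj_a A b = a" for b
    using llab_mem(1)[OF A, of b] that by (auto simp: star_def prod_eq_iff)
  have "(a, x) \<in> llab A ` {b \<in> star T v. lproj_a A b = a}"
    using bij_betw_imp_surj_on[OF bij] x(2) by simp
  then obtain b where b: "b \<in> star T v" "lproj_a A b = a" "llab A b = (a, x)" by auto
  have psi: "scaf_psi \<G> scaff {c} ` gaset \<G> a = {snd (llab A c)}" if "c \<in> star T v" for c
    using psi_quotient[of c] that by (simp add: star_def)
  show ?thesis
  proof (rule ex1I[of _ "{b}"])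
    show "{b} \<in> star (scaf_tree scaff) (cls v) \<and> sproj_a scaff {b} = a \<and> scaf_psi \<G> scaff {b} ` gaset \<G> a = Z"
      using b x psi[OF b(1)] by (simp add: star_quotient[OF v])
    fix E assume E: "E \<in> star (scaf_tree scaff) (cls v) \<and> sproj_a scaff E = a \<and> scaf_psi \<G> scaff E ` gaset \<G> a = Z"
    then obtain c where c: "c \<in> star T v" "E = {c}" using star_quotient[OF v] by auto
    then have "lproj_a A c = a" "snd (llab A c) = x" using E psi[OF c(1)] x by auto
    then have "llab A c = llab A b" using lab[OF c(1)] b by simp
    then have "c = b"
      using inj_onD[OF bij_betw_imp_inj_on[OF bij]] b c \<open>lproj_a A c = a\<close> by simp
    then show "E = {b}" using c by simp
  qed
qed

lemma is_scaffolding: "is_scaffolding \<G> scaff"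
proof -
  have g: "is_graph (sgraph scaff)"
    by (auto simp: is_graph_iff tree_graph)
  \<comment> \<open>The ends \<open>arev T a\<close> and \<open>a\<close> lie in the classes of the
    origin and the terminus of \<open>a\<close> in the tree, and these differ because a tree has no
    loops.\<close>
  have irr: "(tail (sgraph scaff) a, head (sgraph scaff) a) \<notin> srel scaff" if "a \<in> arcs (sgraph scaff)" for a
    using is_treeD(4)[OF tree(1), of a] that by (simp add: \<kappa>_simps tree_graph)
  have hom: "graph_hom (scaf_tree scaff) (lbase D) (sproj_v scaff) (sproj_a scaff)"
    unfolding graph_hom_def Pi_iff verts_quotient arcs_quotient ball_simps
    by (simp add: quotient_sel sproj_v_cls proj tree_graph)
  have legal: "legal_colouring \<G> scaff"
    unfolding legal_colouring_def verts_quotient arcs_quotient ball_simps Let_def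
  proof (intro conjI ballI)
    fix v assume v: "v \<in> verts T"
    show "bij_betw (scol_v scaff) (cls v) (gvset \<G> (sproj_v scaff (cls v)))"
      using bij_betw_scol_v[OF v] by (simp add: sproj_v_cls[OF v] del: scaff_sel)
  next
    fix b assume "b \<in> arcs T"
    show "bij_betw (scol_a scaff) {b} (gaset \<G> (sproj_a scaff {b}))"
      by (simp add: bij_betw_def)
  next
    fix b assume "b \<in> arcs (sgraph scaff)"
    show "scol_a scaff (arev (sgraph scaff) b) = scol_a scaff b" by simp
  next
    fix b assume b: "b \<in> arcs T"
    let ?a = "sproj_a scaff {b}"
    have a: "?a \<in> arcs (gbase \<G>)" using proj b by simp
    have "scaf_psi \<G> scaff {b} \<in> adhesion_maps \<G> ?a"
      using psi_quotient_adhesion[OF b] by simp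
    \<comment> \<open>Over a self-reverse arc the reverse of \<open>b\<close> has the same
      projection, so its map is an adhesion map for the same arc and hence also a twisted
      one.\<close>
    moreover have "scaf_psi \<G> scaff (arev (scaf_tree scaff) {b}) \<in> twisted_adhesion_maps \<G> ?a"
      if "arev (gbase \<G>) ?a = ?a"
      using psi_quotient_adhesion[OF tree_graph(3)[OF b]] twisted_adhesion_maps_eq[OF a that] that
      by (simp add: quotient_sel[OF b] flip: proj(5)[OF b])
    ultimately show "if arev (gbase \<G>) ?a \<noteq> ?a then scaf_psi \<G> scaff {b} \<in> adhesion_maps \<G> ?a
      else scaf_psi \<G> scaff {b} \<in> adhesion_maps \<G> ?a \<and>
          scaf_psi \<G> scaff (arev (scaf_tree scaff) {b}) \<in> twisted_adhesion_maps \<G> ?a \<or>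
        scaf_psi \<G> scaff (arev (scaf_tree scaff) {b}) \<in> adhesion_maps \<G> ?a \<and>
          scaf_psi \<G> scaff {b} \<in> twisted_adhesion_maps \<G> ?a"
      by presburger
  next
    fix v a Z assume v: "v \<in> verts T" and "a \<in> star (gbase \<G>) (sproj_v scaff (cls v))" "Z \<in> adhesion_sets \<G> a"
    then show "\<exists>!E. E \<in> star (scaf_tree scaff) (cls v) \<and> sproj_a scaff E = a \<and> scaf_psi \<G> scaff E ` gaset \<G> a = Z"
      using ex1_quotient[OF v] by (simp only: sproj_v_cls[OF v] \<G>_sel)
  qed
  show ?thesis
    unfolding is_scaffolding_def
    using g equiv_srel graph_iso_is_tree[OF tree(1) graph_iso_quotient] irr hom legal
    by (simp only: scaff_sel \<G>_sel) blast
qed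

sublocale S: free_scaffolding \<G> scaff
  by unfold_locales (rule is_scaffolding)

text \<open>Only the tree changes in this application of the transfer: the renamings of base
  vertices, base arcs and colours are identities.\<close>

lemma gga_induced_group_scaff:
  "gga_induced_group \<G> scaff = map_aut cls (\<lambda>b. {b}) T (scaf_tree scaff) ` lad_universal_group D A"
proof -
  have "lad_universal_group lad S.labelled =
      map_aut cls (\<lambda>b. {b}) (ltree A) (ltree S.labelled) ` lad_universal_group D A"
  proof (rule lad_universal_group_transfer[OF D A is_lad_lad S.is_associated_tree_labelled,
        where iv = "\<lambda>v. v" and ia = "\<lambda>a. a" and e = "\<lambda>z. z"])
    show "lgrp lad v = extend_perm (\<lambda>z. z) (lad_colours D v) (lad_colours lad v) ` lgrp D v"
      if v: "v \<in> verts (lbase D)" for v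
      using subgroup_BijGroup_mem[OF is_ladD(3)[OF D v]] lgrp_lad[OF v]
      by (simp add: lad_colours_eq extend_perm_id del: lad_sel)
    show "llab S.labelled {b} = llab A b" if b: "b \<in> arcs T" for b
      using llab_mem(1)[OF A b] b disjoint by (auto simp: prod_eq_iff)
  qed (use graph_iso_quotient in \<open>auto simp: sproj_v_cls lad_colours_eq\<close>)
  then show ?thesis
    using S.gga_induced_group_eq by simp
qed

end

section \<open>Diagrams inside the universe of the tree\<close>

text \<open>With tree arcs as colours, any tree vertex is a new colour as soon as vertices and arcs
  are disjoint.\<close>

definition arc_coloured :: "('a, 'b, 'd) local_action_diagram \<Rightarrow> ('c, 'd, 'a, 'b, 'd) labelled_tree \<Rightarrow> bool" where
  "arc_coloured D A \<longleftrightarrow> is_lad D \<and> is_associated_tree D A \<and>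
     (\<forall>a\<in>arcs (lbase D). lcol D a \<subseteq> arcs (ltree A)) \<and>
     (\<forall>a\<in>arcs (lbase D). \<forall>b\<in>arcs (lbase D). a \<noteq> b \<longrightarrow> lcol D a \<inter> lcol D b = {})"

text \<open>
  Base vertices and base arcs are renamed to representatives of their fibres in the tree, and a
  colour x of an arc a to the arc labelled x in the star of the terminus of the representative of a.
\<close>

lemma lad_in_tree_types:
  fixes T' :: "('c, 'd) rgraph"
  assumes D: "is_lad D" and A: "is_associated_tree D A" and i: "graph_iso (ltree A) T' f h"
  obtains D' :: "('c, 'd, 'd) local_action_diagram" and A' :: "('c, 'd, 'c, 'd, 'd) labelled_tree"
  where "arc_coloured D' A'" "ltree A' = T'"
    "lad_universal_group D' A' = map_aut f h (ltree A) T' ` lad_universal_group D A"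
proof -
  let ?T = "ltree A" and ?B = "lbase D"
  note AD = is_associated_treeD[OF A]
  note k = graph_homD[OF AD(3)]
  note ii = graph_isoD[OF i]
  define sv where "sv = inv_into (verts ?T) (lproj_v A)"
  define sa where "sa = inv_into (arcs ?T) (lproj_a A)"
  have sv: "sv v \<in> verts ?T" if "v \<in> verts ?B" for v
    using that unfolding sv_def AD(4)[symmetric] by (rule inv_into_into)
  have sa: "sa a \<in> arcs ?T" "lproj_a A (sa a) = a" if "a \<in> arcs ?B" for a
    using that unfolding sa_def AD(5)[symmetric] by (simp_all add: inv_into_into f_inv_into_f)
  define fib where "fib a = {b \<in> star ?T (head ?T (sa a)). lproj_a A b = a}" for a
  define \<beta> where "\<beta> a x = inv_into (fib a) (llab A) (a, x)" for a x
  have \<beta>: "\<beta> a x \<in> arcs ?T" "lproj_a A (\<beta> a x) = a" "llab A (\<beta> a x) = (a, x)"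
    if a: "a \<in> arcs ?B" and x: "x \<in> lcol D a" for a x
  proof -
    have "head ?B a = lproj_v A (head ?T (sa a))" using k(4)[OF sa(1)[OF a]] sa(2)[OF a] by simp
    then have "bij_betw (llab A) (fib a) ({a} \<times> lcol D a)"
      unfolding fib_def using a sa(1)[OF a] is_graphD[OF AD(2)] by (intro AD(6)) auto
    then have "(a, x) \<in> llab A ` fib a" using x by (simp add: bij_betw_def)
    then have "\<beta> a x \<in> fib a" "llab A (\<beta> a x) = (a, x)"
      unfolding \<beta>_def by (rule inv_into_into, rule f_inv_into_f)
    then show "\<beta> a x \<in> arcs ?T" "lproj_a A (\<beta> a x) = a" "llab A (\<beta> a x) = (a, x)"
      by (auto simp: fib_def star_def)
  qed
  define iv where "iv = f \<circ> sv"
  define ia where "ia = h \<circ> sa"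
  define ex where "ex a x = h (\<beta> a x)" for a x
  have iv: "inj_on iv (verts ?B)"
    unfolding iv_def
  proof (rule comp_inj_on)
    show "inj_on sv (verts ?B)" unfolding sv_def using AD(4) by (intro inj_on_inv_into) simp
    show "inj_on f (sv ` verts ?B)" using sv by (intro inj_on_subset[OF ii(4)]) auto
  qed
  have ia: "inj_on ia (arcs ?B)"
    unfolding ia_def
  proof (rule comp_inj_on)
    show "inj_on sa (arcs ?B)" unfolding sa_def using AD(5) by (intro inj_on_inv_into) simp
    show "inj_on h (sa ` arcs ?B)" using sa(1) by (intro inj_on_subset[OF ii(5)]) auto
  qed
  \<comment> \<open>The label of the tree arc \<open>\<beta> a x\<close> returns both
    \<open>a\<close> and \<open>x\<close>. This gives injectivity of each \<open>ex a\<close> and,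
    at the same time, disjointness of the new colour sets of different arcs.\<close>
  have ex_eq: "a = b \<and> x = y" if "a \<in> arcs ?B" "x \<in> lcol D a" "b \<in> arcs ?B" "y \<in> lcol D b" "ex a x = ex b y" for a b x y
  proof -
    have eq: "\<beta> a x = \<beta> b y"
      by (rule inj_onD[OF ii(5) that(5)[unfolded ex_def] \<beta>(1)[OF that(1,2)] \<beta>(1)[OF that(3,4)]])
    have "(a, x) = llab A (\<beta> a x)" by (rule \<beta>(3)[OF that(1,2), symmetric])
    also have "\<dots> = (b, y)" unfolding eq by (rule \<beta>(3)[OF that(3,4)])
    finally show ?thesis by simp
  qed
  have ex: "inj_on (ex a) (lcol D a)" if "a \<in> arcs ?B" for a
    using ex_eq[OF that _ that] by (auto intro: inj_onI)
  let ?D = "map_lad iv ia ex D" and ?A = "map_labelled_tree f h iv ia ex T' A"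
  have base: "arcs (lbase ?D) = ia ` arcs ?B"
    by (simp add: map_lad_def map_graph_def Let_def)
  have col: "lcol ?D (ia a) = ex a ` lcol D a" if "a \<in> arcs ?B" for a
    by (rule lcol_map_lad[OF D iv ia ex that])
  have tree: "ltree ?A = T'" by (simp add: map_labelled_tree_def)
  have "lcol ?D a' \<subseteq> arcs T'" if a': "a' \<in> arcs (lbase ?D)" for a'
  proof -
    obtain a where a: "a \<in> arcs ?B" "a' = ia a" using a' unfolding base by blast
    have "ex a x \<in> arcs T'" if "x \<in> lcol D a" for x
      using imageI[OF \<beta>(1)[OF a(1) that], of h] unfolding ex_def ii(7) .
    then show ?thesis using a by (auto simp: col)
  qed
  moreover have "lcol ?D a' \<inter> lcol ?D b' = {}"
    if a': "a' \<in> arcs (lbase ?D)" and b': "b' \<in> arcs (lbase ?D)" and neq: "a' \<noteq> b'" for a' b'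
  proof -
    obtain a b where ab: "a \<in> arcs ?B" "b \<in> arcs ?B" "a' = ia a" "b' = ia b"
      using a' b' unfolding base by blast
    have "False" if "x \<in> lcol D a" "y \<in> lcol D b" "ex a x = ex b y" for x y
      using ex_eq[OF ab(1) that(1) ab(2) that(2,3)] ab(3,4) neq by simp
    then show ?thesis
      unfolding ab(3,4) col[OF ab(1)] col[OF ab(2)] by blast
  qed
  ultimately have "arc_coloured ?D ?A"
    using is_lad_map_lad[OF D iv ia ex] is_associated_tree_map[OF D A i iv ia ex] tree
    by (simp add: arc_coloured_def)
  then show thesis
  proof (rule that)
    show "ltree ?A = T'" by (rule tree)
    show "lad_universal_group ?D ?A = map_aut f h ?T T' ` lad_universal_group D A"
      by (rule lad_universal_group_map[OF D A i iv ia ex])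
  qed
qed

text \<open>The types of \<open>D\<close> and \<open>A\<close> are arbitrary, since the new diagram
  consists of pieces of a copy of \<open>T\<close>. Hence the two sides of the equivalence may use
  unrelated type variables. The injections \<open>Inl\<close> and \<open>Inr \<circ> Inl\<close>
  keep vertices and arcs of the copy apart.\<close>

lemma lad_in_univ:
  fixes T :: "('v, 'e) rgraph"
  assumes T: "is_tree T" and D: "is_lad D" and A: "is_associated_tree D A"
    and act: "isomorphic_to_aut_action G T \<alpha> (lad_universal_group D A) (ltree A)"
  obtains D' :: "('v, 'e, 'u) univ lad_in" and A' :: "('v, 'e, 'u) univ tree_in"
  where "arc_coloured D' A'" "verts (ltree A') \<inter> arcs (ltree A') = {}"
    "isomorphic_to_aut_action G T \<alpha> (lad_universal_group D' A') (ltree A')"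
proof -
  define T' :: "(('v, 'e, 'u) univ, ('v, 'e, 'u) univ) rgraph"
    where "T' = map_graph Inl (Inr \<circ> Inl) T"
  \<comment> \<open>The isomorphism of actions contains one of trees from \<open>T\<close> to
    \<open>ltree A\<close>; its inverse followed by the embedding of \<open>T\<close> leads into the
    universe.\<close>
  obtain f0 h0 where "graph_iso T (ltree A) f0 h0"
    using act by (auto simp: isomorphic_to_aut_action_def isomorphic_tree_actions_def)
  then have "graph_iso (ltree A) T (inv_into (verts T) f0) (inv_into (arcs T) h0)"
    by (rule graph_iso_inv[OF is_treeD(2)[OF T]])
  moreover have "graph_iso T T' Inl (Inr \<circ> Inl)"
    unfolding T'_def by (rule graph_iso_map_graph) (auto simp: inj_on_def)
  ultimately obtain f h where i: "graph_iso (ltree A) T' f h"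
    using graph_iso_trans by blast
  have disj: "verts T' \<inter> arcs T' = {}"
    by (auto simp: T'_def map_graph_def)
  obtain D' :: "('v, 'e, 'u) univ lad_in" and A' :: "('v, 'e, 'u) univ tree_in"
    where D': "arc_coloured D' A'" and T': "ltree A' = T'"
      and grp: "lad_universal_group D' A' = map_aut f h (ltree A) T' ` lad_universal_group D A"
    by (rule lad_in_tree_types[OF D A i])
  have "isomorphic_to_aut_action G T \<alpha> (lad_universal_group D' A') (ltree A')"
    unfolding grp T' by (rule isomorphic_to_aut_action_transfer[OF act i lad_universal_group_subset])
  then show thesis
    by (rule that[OF D' disj[folded T']])
qed

theorem proposition9p8:
  fixes G :: "('g, 'm) monoid_scheme"
    and T :: "('v, 'e) rgraph"
    and \<alpha> :: "'g \<Rightarrow> ('v \<Rightarrow> 'v) \<times> ('e \<Rightarrow> 'e)"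
  assumes "faithful_tree_action G T \<alpha>"
  shows
    "(\<exists>(D :: ('v, 'e, 'u) univ lad_in) (A :: ('v, 'e, 'u) univ tree_in).
        is_lad D \<and> is_associated_tree D A \<and>
        isomorphic_to_aut_action G T \<alpha> (lad_universal_group D A) (ltree A)) \<longleftrightarrow>
     (\<exists>(\<G> :: ('v, 'e, 'w) univ gga_in) (S :: ('v, 'e, 'w) univ scaffolding_in).
        is_free_gga \<G> \<and> is_scaffolding \<G> S \<and>
        isomorphic_to_aut_action G T \<alpha> (gga_induced_group \<G> S) (scaf_tree S))"
    (is "?lad \<longleftrightarrow> ?gga")
proof
  have tree: "is_tree T" using assms by (simp add: faithful_tree_action_def)
  show ?gga if ?lad
  proof -
    from that obtain D0 :: "('v, 'e, 'u) univ lad_in" and A0 :: "('v, 'e, 'u) univ tree_in"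
      where lad0: "is_lad D0" "is_associated_tree D0 A0"
        "isomorphic_to_aut_action G T \<alpha> (lad_universal_group D0 A0) (ltree A0)" by blast
    \<comment> \<open>This passes from the universe over \<open>'u\<close> to the one over
      \<open>'w\<close> and, at the same time, to disjoint colour sets made of tree arcs.\<close>
    obtain D :: "('v, 'e, 'w) univ lad_in" and A :: "('v, 'e, 'w) univ tree_in"
      where D: "arc_coloured D A" and disj: "verts (ltree A) \<inter> arcs (ltree A) = {}"
        and act: "isomorphic_to_aut_action G T \<alpha> (lad_universal_group D A) (ltree A)"
      by (rule lad_in_univ[OF tree lad0])
    \<comment> \<open>A tree vertex is not a colour, so it can be the additional one; it also serves
      as \<open>y0\<close>, which may be any element of the type.\<close>
    obtain pt where pt: "pt \<in> verts (ltree A)"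
      using is_treeD(3)[OF is_associated_treeD(1), of D A] D by (auto simp: arc_coloured_def)
    interpret disjoint_lad D A pt pt
      by unfold_locales (use D disj pt in \<open>auto simp: arc_coloured_def\<close>)
    have "isomorphic_to_aut_action G T \<alpha> (gga_induced_group \<G> scaff) (scaf_tree scaff)"
      unfolding gga_induced_group_scaff
      by (rule isomorphic_to_aut_action_transfer[OF act graph_iso_quotient lad_universal_group_subset])
    then show ?gga using is_free_gga is_scaffolding by blast
  qed
  show ?lad if ?gga
  proof -
    from that obtain \<G> :: "('v, 'e, 'w) univ gga_in" and S :: "('v, 'e, 'w) univ scaffolding_in"
      where given: "is_free_gga \<G>" "is_scaffolding \<G> S"
        "isomorphic_to_aut_action G T \<alpha> (gga_induced_group \<G> S) (scaf_tree S)" by blast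
    interpret free_scaffolding \<G> S
      by unfold_locales (fact given)+
    have "isomorphic_to_aut_action G T \<alpha> (lad_universal_group lad labelled) (ltree labelled)"
      using given(3) by (simp add: gga_induced_group_eq)
    \<comment> \<open>The tree of \<open>labelled\<close> has classes, that is sets, as vertices and
      arcs, so it lies outside the universe and has to be moved there.\<close>
    then obtain D :: "('v, 'e, 'u) univ lad_in" and A :: "('v, 'e, 'u) univ tree_in"
      where "arc_coloured D A" "isomorphic_to_aut_action G T \<alpha> (lad_universal_group D A) (ltree A)"
      by (rule lad_in_univ[OF tree is_lad_lad is_associated_tree_labelled])
    then show ?lad by (auto simp: arc_coloured_def)
  qed
qed

end
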